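(* (i) The set of stationary $L^2$ harmonic solutions of the Euler equations on the hyperbolic plane $\mathbb{H}^2$ contains an infinite-dimensional vector space. (ii) For every $n>2$, there are no (nonzero) stationary $L^2$ harmonic solutions of the Euler equations on the hyperbolic space $\mathbb{H}^n$.
   Context: Let $M$ be a complete Riemannian manifold with Riemannian volume form $\mu$, Levi-Civita covariant derivative $\nabla$, and let $v\mapsto v^\flat$ denote the identification of vector fields with 1-forms via the metric (with inverse $\sharp$). The Euler equations on $M$ are $\partial_t v+\nabla_v v=-\mathrm{grad}\,p$, $\mathrm{div}\,v=0$, for a time-dependent vector field $v$ and function $p$. A steady (stationary) solution is a time-independent divergence-free vector field $v$ such that $\nabla_v v=-\mathrm{grad}\,p$ for some function $p$ on $M$; equivalently, in the Hamiltonian formulation on the dual space $\Omega^1_{L^2}/\overline{d\Omega^0_{L^2}}$ of the Lie algebra of $L^2$ divergence-free vector fields, the Lie derivative $L_v v^\flat$ lies in the $L^2$-closure $\overline{d\Omega^0_{L^2}}$ of differentials of $L^2$ functions. A 1-form $\alpha$ is harmonic if $\Delta\alpha=0$ for the Hodge Laplacian $\Delta=d\delta+\delta d$ (for $L^2$ forms on a complete manifold this is equivalent to $d\alpha=0$ and $\delta\alpha=0$). A stationary $L^2$ harmonic solution is a steady solution $v$ of the Euler equations such that $v^\flat$ is a harmonic 1-form with finite $L^2$ norm $\int_M |v^\flat|^2\,d\mu<\infty$. *)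

theory Defs
  imports "HOL-Analysis.Analysis"
begin

text \<open>
  Riemannian geometry in a single global chart: an open set U of real^'n with a
  metric tensor g :: real^'n => real^'n^'n (symmetric positive definite matrices).
  Vector fields and 1-forms are represented by their component vectors.
  Hyperbolic n-space is realised by the Poincare ball model.
\<close>

definition partial :: "'n::finite \<Rightarrow> (real^'n \<Rightarrow> real) \<Rightarrow> real^'n \<Rightarrow> real" where
  "partial i f x = deriv (\<lambda>t. f (x + t *\<^sub>R axis i 1)) 0"

fun iter_partial :: "'n::finite list \<Rightarrow> (real^'n \<Rightarrow> real) \<Rightarrow> real^'n \<Rightarrow> real" where
  "iter_partial [] f = f"
| "iter_partial (i # is) f = (\<lambda>x. partial i (iter_partial is f) x)"

definition smooth_fun :: "(real^'n::finite) set \<Rightarrow> (real^'n \<Rightarrow> real) \<Rightarrow> bool" where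
  "smooth_fun U f \<longleftrightarrow> (\<forall>is. \<forall>x\<in>U. iter_partial is f differentiable (at x))"

definition smooth_field :: "(real^'n::finite) set \<Rightarrow> (real^'n \<Rightarrow> real^'n) \<Rightarrow> bool" where
  "smooth_field U v \<longleftrightarrow> (\<forall>k. smooth_fun U (\<lambda>x. v x $ k))"

definition ginv :: "(real^'n \<Rightarrow> real^'n^'n) \<Rightarrow> real^'n \<Rightarrow> real^'n^'n" where
  "ginv g x = matrix_inv (g x)"

definition vol_density :: "(real^'n::finite \<Rightarrow> real^'n^'n) \<Rightarrow> real^'n \<Rightarrow> real" where
  "vol_density g x = sqrt (det (g x))"

definition christoffel :: "(real^'n::finite \<Rightarrow> real^'n^'n) \<Rightarrow> 'n \<Rightarrow> 'n \<Rightarrow> 'n \<Rightarrow> real^'n \<Rightarrow> real" where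
  "christoffel g k i j x = (1/2) * (\<Sum>l\<in>UNIV. ginv g x $ k $ l *
      (partial i (\<lambda>y. g y $ j $ l) x + partial j (\<lambda>y. g y $ i $ l) x - partial l (\<lambda>y. g y $ i $ j) x))"

definition covder :: "(real^'n::finite \<Rightarrow> real^'n^'n) \<Rightarrow> (real^'n \<Rightarrow> real^'n) \<Rightarrow> (real^'n \<Rightarrow> real^'n) \<Rightarrow> real^'n \<Rightarrow> real^'n" where
  "covder g v w x = (\<chi> k. (\<Sum>i\<in>UNIV. v x $ i * partial i (\<lambda>y. w y $ k) x)
       + (\<Sum>i\<in>UNIV. \<Sum>j\<in>UNIV. christoffel g k i j x * v x $ i * w x $ j))"

definition rgrad :: "(real^'n::finite \<Rightarrow> real^'n^'n) \<Rightarrow> (real^'n \<Rightarrow> real) \<Rightarrow> real^'n \<Rightarrow> real^'n" where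
  "rgrad g p x = (\<chi> k. \<Sum>l\<in>UNIV. ginv g x $ k $ l * partial l p x)"

definition rdiv :: "(real^'n::finite \<Rightarrow> real^'n^'n) \<Rightarrow> (real^'n \<Rightarrow> real^'n) \<Rightarrow> real^'n \<Rightarrow> real" where
  "rdiv g v x = (1 / vol_density g x) * (\<Sum>i\<in>UNIV. partial i (\<lambda>y. vol_density g y * v y $ i) x)"

definition flat :: "(real^'n::finite \<Rightarrow> real^'n^'n) \<Rightarrow> (real^'n \<Rightarrow> real^'n) \<Rightarrow> real^'n \<Rightarrow> real^'n" where
  "flat g v x = (\<chi> i. \<Sum>j\<in>UNIV. g x $ i $ j * v x $ j)"

definition sharp :: "(real^'n::finite \<Rightarrow> real^'n^'n) \<Rightarrow> (real^'n \<Rightarrow> real^'n) \<Rightarrow> real^'n \<Rightarrow> real^'n" where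
  "sharp g \<alpha> x = (\<chi> i. \<Sum>j\<in>UNIV. ginv g x $ i $ j * \<alpha> x $ j)"

text \<open>Exterior derivative of functions and of 1-forms (2-forms as antisymmetric matrices beta_ij).\<close>
definition d0 :: "(real^'n::finite \<Rightarrow> real) \<Rightarrow> real^'n \<Rightarrow> real^'n" where
  "d0 f x = (\<chi> i. partial i f x)"

definition d1 :: "(real^'n::finite \<Rightarrow> real^'n) \<Rightarrow> real^'n \<Rightarrow> real^'n^'n" where
  "d1 \<alpha> x = (\<chi> i j. partial i (\<lambda>y. \<alpha> y $ j) x - partial j (\<lambda>y. \<alpha> y $ i) x)"

text \<open>Codifferentials (formal L2 adjoints of d).\<close>
definition codiff1 :: "(real^'n::finite \<Rightarrow> real^'n^'n) \<Rightarrow> (real^'n \<Rightarrow> real^'n) \<Rightarrow> real^'n \<Rightarrow> real" where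
  "codiff1 g \<alpha> x = - rdiv g (sharp g \<alpha>) x"

definition codiff2 :: "(real^'n::finite \<Rightarrow> real^'n^'n) \<Rightarrow> (real^'n \<Rightarrow> real^'n^'n) \<Rightarrow> real^'n \<Rightarrow> real^'n" where
  "codiff2 g \<beta> x = (\<chi> k. \<Sum>j\<in>UNIV. g x $ k $ j *
      (- (1 / vol_density g x) * (\<Sum>i\<in>UNIV. partial i (\<lambda>y. vol_density g y *
          (\<Sum>a\<in>UNIV. \<Sum>b\<in>UNIV. ginv g y $ i $ a * ginv g y $ j $ b * \<beta> y $ a $ b)) x)))"

definition hodge_laplacian1 :: "(real^'n::finite \<Rightarrow> real^'n^'n) \<Rightarrow> (real^'n \<Rightarrow> real^'n) \<Rightarrow> real^'n \<Rightarrow> real^'n" where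
  "hodge_laplacian1 g \<alpha> x = d0 (codiff1 g \<alpha>) x + codiff2 g (d1 \<alpha>) x"

definition harmonic1 :: "(real^'n::finite \<Rightarrow> real^'n^'n) \<Rightarrow> (real^'n) set \<Rightarrow> (real^'n \<Rightarrow> real^'n) \<Rightarrow> bool" where
  "harmonic1 g U \<alpha> \<longleftrightarrow> (\<forall>x\<in>U. hodge_laplacian1 g \<alpha> x = 0)"

definition form_norm2 :: "(real^'n::finite \<Rightarrow> real^'n^'n) \<Rightarrow> (real^'n \<Rightarrow> real^'n) \<Rightarrow> real^'n \<Rightarrow> real" where
  "form_norm2 g \<alpha> x = (\<Sum>i\<in>UNIV. \<Sum>j\<in>UNIV. ginv g x $ i $ j * \<alpha> x $ i * \<alpha> x $ j)"

definition L2_form :: "(real^'n::finite \<Rightarrow> real^'n^'n) \<Rightarrow> (real^'n) set \<Rightarrow> (real^'n \<Rightarrow> real^'n) \<Rightarrow> bool" where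
  "L2_form g U \<alpha> \<longleftrightarrow>
     (\<integral>\<^sup>+ x. indicator U x * ennreal (form_norm2 g \<alpha> x * vol_density g x) \<partial>lborel) < \<infinity>"

definition steady_euler :: "(real^'n::finite \<Rightarrow> real^'n^'n) \<Rightarrow> (real^'n) set \<Rightarrow> (real^'n \<Rightarrow> real^'n) \<Rightarrow> bool" where
  "steady_euler g U v \<longleftrightarrow> smooth_field U v \<and> (\<forall>x\<in>U. rdiv g v x = 0) \<and>
     (\<exists>p. smooth_fun U p \<and> (\<forall>x\<in>U. covder g v v x = - rgrad g p x))"

definition stationary_L2_harmonic :: "(real^'n::finite \<Rightarrow> real^'n^'n) \<Rightarrow> (real^'n) set \<Rightarrow> (real^'n \<Rightarrow> real^'n) \<Rightarrow> bool" where
  "stationary_L2_harmonic g U v \<longleftrightarrow>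
     steady_euler g U v \<and> harmonic1 g U (flat g v) \<and> L2_form g U (flat g v)"

text \<open>Hyperbolic n-space: Poincare ball model, U = ball 0 1, g = (4/(1-|x|^2)^2) delta.\<close>
definition hyp_metric :: "real^'n::finite \<Rightarrow> real^'n^'n" where
  "hyp_metric x = (4 / (1 - (norm x)^2)^2) *\<^sub>R mat 1"

definition hyp_stationary_L2_harmonic :: "(real^'n::finite \<Rightarrow> real^'n) \<Rightarrow> bool" where
  "hyp_stationary_L2_harmonic v \<longleftrightarrow> stationary_L2_harmonic hyp_metric (ball 0 1) v"

definition lin_indep_fields :: "(real^'n::finite) set \<Rightarrow> (real^'n \<Rightarrow> real^'n) set \<Rightarrow> bool" where
  "lin_indep_fields U F \<longleftrightarrow>
     (\<forall>c. (\<forall>x\<in>U. (\<Sum>f\<in>F. c f *\<^sub>R f x) = 0) \<longrightarrow> (\<forall>f\<in>F. c f = 0))"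

end

theory Submission
  imports Defs "HOL-Computational_Algebra.Polynomial"
begin

text \<open>
  In dimension 2 the Dirichlet integral is conformally invariant, so the differentials of harmonic
  polynomials on the disc are \<open>L\<^sup>2\<close> harmonic forms of the hyperbolic plane.  For a closed and coclosed
  form, \<open>\<nabla>\<^sub>v v\<close> is the gradient of \<open>|v|\<^sup>2 / 2\<close>, so the corresponding fields are steady.

  For \<open>n > 2\<close>, let \<open>\<alpha>\<close> be the form of a stationary \<open>L\<^sup>2\<close> harmonic solution.  It is coclosed, so
  \<open>\<delta> d \<alpha> = 0\<close>, and integrating against \<open>\<eta>\<^sup>2 \<alpha>\<close>, for cutoffs \<open>\<eta>\<close> whose hyperbolic gradient tends to 0,
  gives \<open>d \<alpha> = 0\<close>.  The stress-energy tensor \<open>|\<alpha>|\<^sup>2 g / 2 - \<alpha> \<otimes> \<alpha>\<close> is then divergence free.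
  Contracting it with the radial field \<open>X = (1 - |x|\<^sup>2) x\<close>, whose length is bounded, and using the same
  cutoffs gives an integral of a quadratic form in \<open>\<alpha>\<close> that must vanish; it is positive definite
  exactly because \<open>n > 2\<close>.
\<close>

section \<open>Partial derivatives and smooth functions\<close>

text \<open>\<open>partial\<close> is a derivative along a line, hence the Frechet derivative
  applied to a basis vector. All calculus rules below reduce in this way to those for
  \<open>has_derivative\<close>.\<close>

lemma partial_eq:
  assumes "(f has_derivative f') (at x)"
  shows "partial i f x = f' (axis i 1)"
proof -
  have "((\<lambda>t::real. x + t *\<^sub>R axis i 1) has_derivative (\<lambda>t. t *\<^sub>R axis i 1)) (at 0)"
    by (auto intro!: derivative_eq_intros)
  then have "((\<lambda>t::real. f (x + t *\<^sub>R axis i 1)) has_derivative (\<lambda>t. f' (t *\<^sub>R axis i 1))) (at 0)"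
    by (rule has_derivative_compose) (use assms in simp)
  moreover have "f' (t *\<^sub>R axis i 1) = f' (axis i 1) * t" for t
    using has_derivative_linear[OF assms] by (simp add: linear_scale)
  ultimately have "((\<lambda>t. f (x + t *\<^sub>R axis i 1)) has_real_derivative f' (axis i 1)) (at 0)"
    by (simp add: has_field_derivative_def)
  then show ?thesis
    unfolding partial_def by (rule DERIV_imp_deriv)
qed

lemma has_real_derivative_partial:
  assumes "f differentiable (at x)"
  shows "((\<lambda>t. f (x + t *\<^sub>R axis i 1)) has_real_derivative partial i f x) (at 0)"
proof -
  obtain f' where f': "(f has_derivative f') (at x)"
    using assms by (auto simp: differentiable_def)
  have "((\<lambda>t::real. x + t *\<^sub>R axis i 1) has_derivative (\<lambda>t. t *\<^sub>R axis i 1)) (at 0)"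
    by (auto intro!: derivative_eq_intros)
  then have "((\<lambda>t::real. f (x + t *\<^sub>R axis i 1)) has_derivative (\<lambda>t. f' (t *\<^sub>R axis i 1))) (at 0)"
    by (rule has_derivative_compose) (use f' in simp)
  then have "((\<lambda>t. f (x + t *\<^sub>R axis i 1)) differentiable at 0)"
    by (auto simp: differentiable_def)
  then show ?thesis
    unfolding partial_def
    using DERIV_deriv_iff_real_differentiable by blast
qed

text \<open>A derivative depends only on the germ, and the line through \<open>x\<close> stays in
  \<open>U\<close> for small \<open>t\<close>. This allows closed formulas that are valid only on
  the ball to be differentiated.\<close>

lemma partial_cong:
  assumes "open U" "x \<in> U" "\<And>y. y \<in> U \<Longrightarrow> f y = g y"
  shows "partial i f x = partial i g x"
proof -
  have "isCont (\<lambda>t::real. x + t *\<^sub>R axis i (1::real)) 0"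
    by (intro continuous_intros)
  then have "\<forall>\<^sub>F t in at 0. x + t *\<^sub>R axis i (1::real) \<in> U"
    using assms(1,2) by (auto simp: isCont_def intro: topological_tendstoD)
  then have "\<forall>\<^sub>F t in nhds 0. x + t *\<^sub>R axis i (1::real) \<in> U"
    using assms(2) by (simp add: eventually_nhds_conv_at)
  then have "\<forall>\<^sub>F t in nhds 0. f (x + t *\<^sub>R axis i 1) = g (x + t *\<^sub>R axis i 1)"
    by eventually_elim (rule assms(3))
  then show ?thesis
    unfolding partial_def by (intro deriv_cong_ev) auto
qed

lemma differentiable_cong_open:
  assumes "open U" "x \<in> U" "\<And>y. y \<in> U \<Longrightarrow> f y = g y" "f differentiable (at x)"
  shows "g differentiable (at x)"
  using assms by (meson differentiable_def has_derivative_transform_within_open)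

lemma partial_const [simp]: "partial i (\<lambda>x. c) = (\<lambda>x. 0)"
  by (rule ext) (simp add: partial_def)

lemma partial_coord: "partial i (\<lambda>x. x $ j) x = (if i = j then 1 else 0)"
proof -
  have "((\<lambda>x::real^'a. x $ j) has_derivative (\<lambda>h. h $ j)) (at x)"
    by (rule bounded_linear_imp_has_derivative) (rule bounded_linear_vec_nth)
  from partial_eq[OF this] show ?thesis by (auto simp: axis_def)
qed

lemma partial_add:
  assumes "f differentiable (at x)" "g differentiable (at x)"
  shows "partial i (\<lambda>y. f y + g y) x = partial i f x + partial i g x"
proof -
  obtain f' g' where *: "(f has_derivative f') (at x)" "(g has_derivative g') (at x)"
    using assms by (auto simp: differentiable_def)
  show ?thesis
    using partial_eq[OF has_derivative_add[OF *]] partial_eq[OF *(1)] partial_eq[OF *(2)] by simp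
qed

lemma partial_mult:
  assumes "f differentiable (at x)" "g differentiable (at x)"
  shows "partial i (\<lambda>y. f y * g y) x = f x * partial i g x + partial i f x * g x"
proof -
  obtain f' g' where *: "(f has_derivative f') (at x)" "(g has_derivative g') (at x)"
    using assms by (auto simp: differentiable_def)
  show ?thesis
    using partial_eq[OF has_derivative_mult[OF *]] partial_eq[OF *(1)] partial_eq[OF *(2)] by simp
qed

lemma partial_cmult:
  assumes "f differentiable (at x)"
  shows "partial i (\<lambda>y. c * f y) x = c * partial i f x"
  using partial_mult[OF differentiable_const assms] by simp

lemma partial_minus:
  assumes "f differentiable (at x)"
  shows "partial i (\<lambda>y. - f y) x = - partial i f x"
  using partial_cmult[OF assms, of i "-1"] by simp

lemma partial_diff:
  assumes "f differentiable (at x)" "g differentiable (at x)"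
  shows "partial i (\<lambda>y. f y - g y) x = partial i f x - partial i g x"
  using partial_add[OF assms(1) differentiable_minus[OF assms(2)]] partial_minus[OF assms(2)]
  by simp

lemma partial_sum:
  assumes "\<And>j. j \<in> J \<Longrightarrow> f j differentiable (at x)"
  shows "partial i (\<lambda>y. \<Sum>j\<in>J. f j y) x = (\<Sum>j\<in>J. partial i (f j) x)"
proof -
  from assms obtain f' where *: "\<And>j. j \<in> J \<Longrightarrow> (f j has_derivative f' j) (at x)"
    unfolding differentiable_def by metis
  then show ?thesis
    using partial_eq[OF has_derivative_sum[OF *]] partial_eq[OF *] by simp
qed

lemma partial_inverse:
  assumes "f differentiable (at x)" "f x \<noteq> 0"
  shows "partial i (\<lambda>y. inverse (f y)) x = - (partial i f x * (inverse (f x) * inverse (f x)))"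
proof -
  obtain f' where *: "(f has_derivative f') (at x)"
    using assms by (auto simp: differentiable_def)
  show ?thesis
    using partial_eq[OF Deriv.has_derivative_inverse[OF assms(2) *]] partial_eq[OF *] by simp
qed

lemma partial_power:
  assumes "f differentiable (at x)"
  shows "partial i (\<lambda>y. f y ^ m) x = real m * f x ^ (m - 1) * partial i f x"
proof -
  obtain f' where *: "(f has_derivative f') (at x)"
    using assms by (auto simp: differentiable_def)
  show ?thesis
    using partial_eq[OF has_derivative_power[OF *]] partial_eq[OF *] by (simp add: mult_ac)
qed

section \<open>Closure properties of smooth functions\<close>

text \<open>The recursion of \<open>iter_partial\<close> strips the outermost derivative; this form
  strips the innermost one, so that an induction can replace \<open>f\<close> by
  \<open>partial i f\<close>.\<close>

lemma iter_partial_snoc: "iter_partial (is @ [i]) f = iter_partial is (partial i f)"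
  by (induction "is") auto

lemma smooth_fun_iff:
  "smooth_fun U f \<longleftrightarrow> (\<forall>x\<in>U. f differentiable (at x)) \<and> (\<forall>i. smooth_fun U (partial i f))"
proof
  assume *: "smooth_fun U f"
  show "(\<forall>x\<in>U. f differentiable (at x)) \<and> (\<forall>i. smooth_fun U (partial i f))"
  proof
    show "\<forall>x\<in>U. f differentiable (at x)"
      using *[unfolded smooth_fun_def, rule_format, of _ "[]"] by simp
    show "\<forall>i. smooth_fun U (partial i f)"
      using * by (simp add: smooth_fun_def flip: iter_partial_snoc)
  qed
next
  assume *: "(\<forall>x\<in>U. f differentiable (at x)) \<and> (\<forall>i. smooth_fun U (partial i f))"
  show "smooth_fun U f"
    unfolding smooth_fun_def
  proof (intro allI ballI)
    fix "is" x assume "x \<in> U"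
    then show "iter_partial is f differentiable at x"
      using * by (cases "is" rule: rev_cases) (auto simp: iter_partial_snoc smooth_fun_def)
  qed
qed

text \<open>Closing the smooth functions under the algebraic operations and under equality on \<open>U\<close>
  gives a class whose stability under partial derivatives is a single rule induction.\<close>

inductive smooth_gen :: "(real^'n::finite) set \<Rightarrow> (real^'n \<Rightarrow> real) \<Rightarrow> bool"
  for U where
  base: "smooth_fun U f \<Longrightarrow> smooth_gen U f"
| const: "smooth_gen U (\<lambda>x. c)"
| coord: "smooth_gen U (\<lambda>x. x $ j)"
| add: "smooth_gen U f \<Longrightarrow> smooth_gen U g \<Longrightarrow> smooth_gen U (\<lambda>x. f x + g x)"
| mult: "smooth_gen U f \<Longrightarrow> smooth_gen U g \<Longrightarrow> smooth_gen U (\<lambda>x. f x * g x)"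
| inverse: "smooth_gen U f \<Longrightarrow> (\<And>x. x \<in> U \<Longrightarrow> f x \<noteq> 0) \<Longrightarrow> smooth_gen U (\<lambda>x. inverse (f x))"
| cong: "smooth_gen U f \<Longrightarrow> (\<And>x. x \<in> U \<Longrightarrow> f x = g x) \<Longrightarrow> smooth_gen U g"

text \<open>The sum, product and quotient rules express each partial derivative through the
  generators again. They hold only on \<open>U\<close>, and the rule \<open>cong\<close> absorbs
  what happens elsewhere.\<close>

lemma smooth_gen_partial:
  assumes "open U" "smooth_gen U f"
  shows "(\<forall>x\<in>U. f differentiable (at x)) \<and> (\<forall>i. smooth_gen U (partial i f))"
  using assms(2)
proof induction
  case (base f)
  then show ?case
    using smooth_fun_iff[of U f] by (auto intro: smooth_gen.base)
next
  case (const c)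
  then show ?case by (auto intro: smooth_gen.const)
next
  case (coord j)
  have "smooth_gen U (partial i (\<lambda>x. x $ j))" for i
    by (rule smooth_gen.cong[OF smooth_gen.const]) (rule partial_coord[symmetric])
  moreover have "(\<lambda>x. x $ j) differentiable at x" for x :: "real^'a"
    by (rule bounded_linear_imp_differentiable) (rule bounded_linear_vec_nth)
  ultimately show ?case by auto
next
  case (add f g)
  then have "smooth_gen U (partial i (\<lambda>x. f x + g x))" for i
    by (rule_tac smooth_gen.cong[OF smooth_gen.add[of _ "partial i f" "partial i g"]])
       (auto simp: partial_add)
  with add show ?case by auto
next
  case (mult f g)
  then have "smooth_gen U (partial i (\<lambda>x. f x * g x))" for i
    by (rule_tac smooth_gen.cong[OF smooth_gen.add[OF smooth_gen.mult[of _ f "partial i g"]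
          smooth_gen.mult[of _ "partial i f" g]]])
       (auto simp: partial_mult)
  with mult show ?case by auto
next
  case (inverse f)
  let ?h = "\<lambda>x. inverse (f x)"
  have "smooth_gen U ?h"
    using inverse by (auto intro: smooth_gen.inverse)
  then have "smooth_gen U (\<lambda>x. (-1) * (partial i f x * (?h x * ?h x)))" for i
    using inverse by (intro smooth_gen.mult smooth_gen.const) auto
  then have "smooth_gen U (partial i ?h)" for i
    by (rule smooth_gen.cong) (use inverse in \<open>auto simp: partial_inverse\<close>)
  with inverse show ?case by auto
next
  case (cong f g)
  then have "smooth_gen U (partial i g)" for i
    by (rule_tac smooth_gen.cong[of _ "partial i f"]) (auto intro: partial_cong[OF assms(1)])
  with cong show ?case
    using differentiable_cong_open[OF assms(1)] by blast
qed

text \<open>Induction on the list from the right, with \<open>f\<close> arbitrary: the innermost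
  derivative of a generated function is again generated.\<close>

lemma smooth_gen_imp_smooth_fun:
  assumes "open U" "smooth_gen U f"
  shows "smooth_fun U f"
  unfolding smooth_fun_def
proof
  fix "is"
  show "\<forall>x\<in>U. iter_partial is f differentiable at x"
    using assms(2)
  proof (induction "is" arbitrary: f rule: rev_induct)
    case Nil
    then show ?case using smooth_gen_partial[OF assms(1)] by simp
  next
    case (snoc i "is")
    then show ?case using smooth_gen_partial[OF assms(1)] by (simp add: iter_partial_snoc)
  qed
qed

context
  fixes U :: "(real^'n::finite) set"
  assumes U: "open U"
begin

lemma smooth_fun_const: "smooth_fun U (\<lambda>x. c)"
  and smooth_fun_coord: "smooth_fun U (\<lambda>x. x $ j)"
  by (auto intro: smooth_gen_imp_smooth_fun[OF U] smooth_gen.intros)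

lemma smooth_fun_add: "smooth_fun U f \<Longrightarrow> smooth_fun U g \<Longrightarrow> smooth_fun U (\<lambda>x. f x + g x)"
  and smooth_fun_mult: "smooth_fun U f \<Longrightarrow> smooth_fun U g \<Longrightarrow> smooth_fun U (\<lambda>x. f x * g x)"
  by (auto intro!: smooth_gen_imp_smooth_fun[OF U] smooth_gen.add smooth_gen.mult
      intro: smooth_gen.base)

lemma smooth_fun_inverse:
  "smooth_fun U f \<Longrightarrow> (\<And>x. x \<in> U \<Longrightarrow> f x \<noteq> 0) \<Longrightarrow> smooth_fun U (\<lambda>x. inverse (f x))"
  by (auto intro!: smooth_gen_imp_smooth_fun[OF U] smooth_gen.inverse intro: smooth_gen.base)

lemma smooth_fun_diff: "smooth_fun U f \<Longrightarrow> smooth_fun U g \<Longrightarrow> smooth_fun U (\<lambda>x. f x - g x)"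
  using smooth_fun_add[OF _ smooth_fun_mult[OF smooth_fun_const[of "-1"]], of f g] by simp

lemma smooth_fun_sum:
  "(\<And>j. j \<in> J \<Longrightarrow> smooth_fun U (f j)) \<Longrightarrow> smooth_fun U (\<lambda>x. \<Sum>j\<in>J. f j x)"
  by (induction J rule: infinite_finite_induct) (auto intro: smooth_fun_const smooth_fun_add)

lemma smooth_fun_power: "smooth_fun U f \<Longrightarrow> smooth_fun U (\<lambda>x. f x ^ m)"
  by (induction m) (auto intro: smooth_fun_const smooth_fun_mult)

end

lemma smooth_fun_partial: "smooth_fun U f \<Longrightarrow> smooth_fun U (partial i f)"
  and smooth_fun_differentiable: "smooth_fun U f \<Longrightarrow> x \<in> U \<Longrightarrow> f differentiable (at x)"
  using smooth_fun_iff by blast+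

lemma smooth_fun_continuous_on: "smooth_fun U f \<Longrightarrow> continuous_on U f"
  by (intro continuous_at_imp_continuous_on ballI differentiable_imp_continuous_within
      smooth_fun_differentiable)

section \<open>Integration by parts with cutoffs\<close>

lemma integral_lborel_translate:
  fixes f :: "'a::euclidean_space \<Rightarrow> real"
  assumes "f \<in> borel_measurable borel"
  shows "(\<integral>x. f (c + x) \<partial>lborel) = (\<integral>x. f x \<partial>lborel)"
proof -
  have "(\<integral>x. f x \<partial>lborel) = (\<integral>x. f x \<partial>distr lborel borel ((+) c))"
    by (simp add: lborel_distr_plus)
  also have "\<dots> = (\<integral>x. f (c + x) \<partial>lborel)"
    by (rule integral_distr) (use assms in auto)
  finally show ?thesis by simp
qed

lemma integrable_continuous_compact_support:
  fixes f :: "'a::euclidean_space \<Rightarrow> real"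
  assumes "continuous_on UNIV f" "\<And>x. norm x > r \<Longrightarrow> f x = 0"
  shows "integrable lborel f"
proof -
  have "integrable lborel (\<lambda>x. indicator (cball 0 r) x *\<^sub>R f x)"
    by (rule borel_integrable_compact) (use assms(1) continuous_on_subset in auto)
  moreover have "(\<lambda>x. indicator (cball 0 r) x *\<^sub>R f x) = f"
    using assms(2) by (auto simp: fun_eq_iff indicator_def)
  ultimately show ?thesis by simp
qed

text \<open>Difference quotients have integral zero by translation invariance of Lebesgue measure;
  dominated convergence passes this on to the derivative.\<close>

lemma integral_directional_derivative_eq_0:
  fixes G D :: "'a::euclidean_space \<Rightarrow> real"
  assumes deriv: "\<And>x. ((\<lambda>t. G (x + t *\<^sub>R e)) has_real_derivative D x) (at 0)"
    and contG: "continuous_on UNIV G" and contD: "continuous_on UNIV D"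
    and suppG: "\<And>x. norm x > r \<Longrightarrow> G x = 0" and suppD: "\<And>x. norm x > r \<Longrightarrow> D x = 0"
  shows "(\<integral>x. D x \<partial>lborel) = 0"
proof -
  have "bounded (D ` cball 0 r)"
    by (intro compact_imp_bounded compact_continuous_image) (use contD continuous_on_subset in auto)
  then obtain B where "B > 0" "\<forall>x\<in>cball 0 r. \<bar>D x\<bar> \<le> B"
    by (auto simp: bounded_pos)
  then have B: "B \<ge> 0" "\<And>x. norm x \<le> r \<Longrightarrow> \<bar>D x\<bar> \<le> B" by auto
  have DB: "\<bar>D x\<bar> \<le> B" for x
    using B suppD[of x] by (cases "norm x \<le> r") auto
  \<comment> \<open>Moving the base point along the line turns differentiability at parameter 0,
    known at all points, into differentiability at every parameter.\<close>
  have deriv': "((\<lambda>t. G (x + t *\<^sub>R e)) has_real_derivative D (x + t *\<^sub>R e)) (at t)" for x t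
  proof -
    have "((\<lambda>s. G ((x + t *\<^sub>R e) + s *\<^sub>R e)) has_real_derivative D (x + t *\<^sub>R e)) (at (t - t))"
      using deriv[of "x + t *\<^sub>R e"] by simp
    then have "((\<lambda>s. G ((x + t *\<^sub>R e) + (s - t) *\<^sub>R e)) has_real_derivative D (x + t *\<^sub>R e)) (at t)"
      using DERIV_shift[of "\<lambda>s. G ((x + t *\<^sub>R e) + s *\<^sub>R e)" "D (x + t *\<^sub>R e)" t "- t"] by simp
    then show ?thesis by (simp add: algebra_simps)
  qed
  \<comment> \<open>Difference quotients with step \<open>1 / (m + 1)\<close>: never zero and at
    most 1.\<close>
  define Q where "Q m x = (G (x + inverse (real (Suc m)) *\<^sub>R e) - G x) / inverse (real (Suc m))" for m x
  have Qb: "\<bar>Q m x\<bar> \<le> B" for m x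
  proof -
    let ?h = "inverse (real (Suc m))"
    have "?h > 0" by simp
    \<comment> \<open>The mean value theorem bounds the quotients by the supremum of the derivative,
      uniformly in \<open>m\<close>.\<close>
    from MVT2[OF this, of "\<lambda>t. G (x + t *\<^sub>R e)" "\<lambda>t. D (x + t *\<^sub>R e)"] deriv'
    obtain z where z: "G (x + ?h *\<^sub>R e) - G x = ?h * D (x + z *\<^sub>R e)" by auto
    show ?thesis unfolding Q_def z using DB by simp
  qed
  have mG: "G \<in> borel_measurable borel"
    using contG by (rule borel_measurable_continuous_onI)
  have mD: "D \<in> borel_measurable borel"
    using contD by (rule borel_measurable_continuous_onI)
  have iG: "integrable lborel G"
    by (rule integrable_continuous_compact_support[OF contG suppG])
  have iG': "integrable lborel (\<lambda>x. G (x + c))" for c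
  proof (rule integrable_continuous_compact_support[where r = "r + norm c"])
    show "continuous_on UNIV (\<lambda>x. G (x + c))"
      by (rule continuous_on_compose2[OF contG]) (auto intro: continuous_intros)
    show "G (x + c) = 0" if "norm x > r + norm c" for x
      using that norm_triangle_ineq[of "x + c" "- c"] by (intro suppG) simp
  qed
  have intQ: "(\<integral>x. Q m x \<partial>lborel) = 0" for m
  proof -
    have "(\<integral>x. G (x + c) \<partial>lborel) = (\<integral>x. G x \<partial>lborel)" for c
      using integral_lborel_translate[OF mG, of c] by (simp add: add.commute)
    then show ?thesis
      unfolding Q_def by (simp add: iG iG' Bochner_Integration.integral_diff del: of_nat_Suc)
  qed
  have mQ: "Q m \<in> borel_measurable borel" for m
  proof -
    have "continuous_on UNIV (\<lambda>x. G (x + c))" for c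
      by (rule continuous_on_compose2[OF contG]) (auto intro: continuous_intros)
    then have "(\<lambda>x. G (x + c)) \<in> borel_measurable borel" for c
      by (rule borel_measurable_continuous_onI)
    then show ?thesis using mG unfolding Q_def[abs_def] by measurable
  qed
  have "(\<lambda>m. \<integral>x. Q m x \<partial>lborel) \<longlonglongrightarrow> (\<integral>x. D x \<partial>lborel)"
  \<comment> \<open>Since the steps are at most 1, all quotients vanish outside the ball of radius
    \<open>r + norm e\<close>, so one constant on that ball dominates them.\<close>
  proof (rule integral_dominated_convergence[where w = "\<lambda>x. indicator (cball 0 (r + norm e)) x *\<^sub>R B"])
    show "integrable lborel (\<lambda>x. indicator (cball 0 (r + norm e)) x *\<^sub>R B)"
      by (rule borel_integrable_compact) auto
    show "AE x in lborel. (\<lambda>m. Q m x) \<longlonglongrightarrow> D x"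
    proof (rule AE_I2)
      fix x
      have "((\<lambda>h. (G (x + (0 + h) *\<^sub>R e) - G (x + 0 *\<^sub>R e)) / h) \<longlongrightarrow> D x) (at 0)"
        using deriv[of x] unfolding DERIV_def by simp
      moreover have "filterlim (\<lambda>m. inverse (real (Suc m))) (at 0) sequentially"
        using LIMSEQ_inverse_real_of_nat by (auto simp: filterlim_at)
      ultimately show "(\<lambda>m. Q m x) \<longlonglongrightarrow> D x"
        unfolding Q_def by (auto dest: filterlim_compose)
    qed
    show "AE x in lborel. norm (Q m x) \<le> indicator (cball 0 (r + norm e)) x *\<^sub>R B" for m
    proof (rule AE_I2)
      fix x
      let ?h = "inverse (real (Suc m))"
      show "norm (Q m x) \<le> indicator (cball 0 (r + norm e)) x *\<^sub>R B"
      proof (cases "norm x \<le> r + norm e")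
        case True
        then show ?thesis using Qb[of m x] by simp
      next
        case False
        have "?h * norm e \<le> 1 * norm e"
          by (intro mult_right_mono) (auto simp: field_simps)
        moreover have "norm x \<le> norm (x + ?h *\<^sub>R e) + ?h * norm e"
          using norm_triangle_ineq[of "x + ?h *\<^sub>R e" "- (?h *\<^sub>R e)"] by (simp del: of_nat_Suc)
        ultimately have "norm (x + ?h *\<^sub>R e) > r" using False by linarith
        moreover have "norm x > r" using False norm_ge_zero[of e] by linarith
        ultimately have "Q m x = 0" unfolding Q_def using suppG by simp
        then show ?thesis using B by (simp add: indicator_def)
      qed
    qed
  qed (use mD mQ in auto)
  then have "(\<lambda>m::nat. 0::real) \<longlonglongrightarrow> (\<integral>x. D x \<partial>lborel)"
    by (simp add: intQ)
  then show ?thesis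
    using LIMSEQ_unique tendsto_const by blast
qed

text \<open>A nonnegative function with nonpositive integral vanishes almost everywhere; by
  continuity its nonzero set is open, and an open negligible set is empty.\<close>

lemma vanishing_if_integral_nonpos:
  fixes f :: "'a::euclidean_space \<Rightarrow> real"
  assumes cont: "continuous_on UNIV f" and int: "integrable lborel f"
    and nonneg: "\<And>x. f x \<ge> 0" and le: "(\<integral>x. f x \<partial>lborel) \<le> 0"
  shows "f x = 0"
proof (rule ccontr)
  assume "f x \<noteq> 0"
  have "(\<integral>x. f x \<partial>lborel) = 0"
    using le nonneg by (intro antisym integral_nonneg_AE) auto
  then have "AE x in lborel. f x = 0"
    using integral_nonneg_eq_0_iff_AE[OF int] nonneg by auto
  then have "AE x in lebesgue. f x = 0"
    by (rule AE_completion)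
  then have "negligible {x. f x \<noteq> 0}"
    by (simp add: completion.AE_iff_null_sets negligible_iff_null_sets eventually_ae_filter)
       (metis (mono_tags, lifting) completion.complete2 mem_Collect_eq subsetI)
  moreover have "open {x. f x \<noteq> 0}"
    by (intro open_Collect_neq cont continuous_intros)
  ultimately show False
    using open_not_negligible \<open>f x \<noteq> 0\<close> by blast
qed

text \<open>In hyperbolic terms \<open>- ln (1 - |x|\<^sup>2)\<close> grows like the distance from the origin, so the
  gradient of the following cutoff has hyperbolic length of order \<open>1/k\<close>.
  The square makes it continuously differentiable.\<close>

definition cutoff_base :: "nat \<Rightarrow> 'a::euclidean_space \<Rightarrow> real" where
  "cutoff_base k x = (if norm x < 1 then max 0 (1 + ln (1 - (norm x)\<^sup>2) / real k) else 0)"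

text \<open>This is the partial derivative of the square of \<open>cutoff_base k\<close>. The factor
  \<open>cutoff_base k x\<close> that survives differentiation makes it vanish wherever the cutoff
  does.\<close>

definition cutoff_grad :: "nat \<Rightarrow> real^'n::finite \<Rightarrow> 'n \<Rightarrow> real" where
  "cutoff_grad k x i = - 4 * cutoff_base k x * x $ i / (real k * (1 - (norm x)\<^sup>2))"

section \<open>Properties of the logarithmic cutoffs\<close>

lemma one_minus_norm_sq_pos: "norm x < 1 \<Longrightarrow> 0 < 1 - (norm x)\<^sup>2"
  by (simp add: power_less_one_iff abs_square_less_1)

lemma cutoff_base_range: "0 \<le> cutoff_base k x" "cutoff_base k x \<le> 1"
proof -
  have "ln (1 - (norm x)\<^sup>2) / real k \<le> 0" if "norm x < 1"
    using one_minus_norm_sq_pos[OF that] by (simp add: divide_nonpos_nonneg)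
  then show "0 \<le> cutoff_base k x" "cutoff_base k x \<le> 1"
    by (auto simp: cutoff_base_def)
qed

text \<open>The logarithm is nonpositive on the ball, so dividing it by a larger number increases
  the cutoff. This is what permits a fixed cutoff to be compared with all later ones.\<close>

lemma cutoff_base_mono:
  assumes "0 < k" "k \<le> l"
  shows "cutoff_base k x \<le> cutoff_base l x"
proof (cases "norm x < 1")
  case True
  have "ln (1 - (norm x)\<^sup>2) \<le> 0"
    using one_minus_norm_sq_pos[OF True] by simp
  then have "ln (1 - (norm x)\<^sup>2) / real k \<le> ln (1 - (norm x)\<^sup>2) / real l"
    using assms by (intro divide_left_mono_neg) auto
  then show ?thesis by (auto simp: cutoff_base_def)
qed (simp add: cutoff_base_def)

lemma cutoff_base_support:
  assumes "0 < k"
  obtains r where "0 \<le> r" "r < 1" "\<And>x::'a::euclidean_space. norm x > r \<Longrightarrow> cutoff_base k x = 0"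
proof
  \<comment> \<open>The radius at which \<open>1 + ln (1 - r\<^sup>2) / real k\<close> is
    zero.\<close>
  let ?r = "sqrt (1 - exp (- real k))"
  show "0 \<le> ?r" "?r < 1" by auto
  fix x :: 'a assume r: "norm x > ?r"
  show "cutoff_base k x = 0"
  proof (cases "norm x < 1")
    case True
    have "1 - exp (- real k) < (norm x)\<^sup>2"
      using r by (metis norm_ge_zero real_sqrt_abs abs_of_nonneg real_sqrt_less_iff)
    then have "1 - (norm x)\<^sup>2 < exp (- real k)" by simp
    then have "ln (1 - (norm x)\<^sup>2) < - real k"
      using one_minus_norm_sq_pos[OF True] by (metis ln_exp ln_less_cancel_iff exp_gt_zero)
    then have "1 + ln (1 - (norm x)\<^sup>2) / real k \<le> 0"
      using assms by (simp add: field_simps)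
    then show ?thesis by (simp add: cutoff_base_def)
  qed (simp add: cutoff_base_def)
qed

lemma continuous_on_cutoff_base: "continuous_on (ball 0 1) (cutoff_base k)"
proof -
  have "continuous_on (ball 0 1) (\<lambda>x::'a. max 0 (1 + ln (1 - (norm x)\<^sup>2) * inverse (real k)))"
    by (intro continuous_intros) (use one_minus_norm_sq_pos in force)
  then show ?thesis
    by (rule continuous_on_eq) (simp add: cutoff_base_def divide_inverse)
qed

text \<open>As \<open>r < 1\<close>, the open ball and the complement of \<open>cball 0 r\<close>
  are two open sets covering the space, and the function is continuous on each.\<close>

lemma continuous_extend_by_zero:
  fixes f :: "'a::euclidean_space \<Rightarrow> real"
  assumes "continuous_on (ball 0 1) f" "r < 1" "\<And>x. norm x > r \<Longrightarrow> f x = 0"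
  shows "continuous_on UNIV f"
proof -
  have o: "open (- cball (0::'a) r)" by auto
  have "continuous_on (- cball 0 r) f"
    by (rule continuous_on_eq[of _ "\<lambda>_. 0"]) (use assms in auto)
  from continuous_on_open_Un[OF open_ball o assms(1) this]
  have "continuous_on (ball 0 1 \<union> - cball 0 r) f" .
  moreover have "ball 0 1 \<union> - cball 0 r = (UNIV :: 'a set)" using assms(2) by auto
  ultimately show ?thesis by simp
qed

text \<open>Only the origin is delicate; there the difference quotient is at most
  \<open>\<bar>h\<bar>\<close>.\<close>

lemma has_real_derivative_square_positive_part:
  "((\<lambda>s. (max 0 s)\<^sup>2) has_real_derivative 2 * max 0 s) (at (s::real))"
proof (cases s "0::real" rule: linorder_cases)
  case less
  have "((\<lambda>s::real. 0) has_real_derivative 2 * max 0 s) (at s)" using less by simp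
  then show ?thesis
    by (rule has_field_derivative_transform_within_open[of _ _ _ "{..<0}"]) (use less in auto)
next
  case greater
  have "((\<lambda>s::real. s\<^sup>2) has_real_derivative 2 * max 0 s) (at s)"
    using greater by (auto intro!: derivative_eq_intros)
  then show ?thesis
    by (rule has_field_derivative_transform_within_open[of _ _ _ "{0<..}"]) (use greater in auto)
next
  case equal
  have "((\<lambda>h::real. (max 0 h)\<^sup>2 / h) \<longlongrightarrow> 0) (at 0)"
  proof (rule Lim_null_comparison)
    show "\<forall>\<^sub>F h in at 0. norm ((max 0 h)\<^sup>2 / h) \<le> \<bar>h::real\<bar>"
      by (rule always_eventually) (auto simp: max_def power2_eq_square)
    show "((\<lambda>h::real. \<bar>h\<bar>) \<longlongrightarrow> 0) (at 0)"
      by (intro tendsto_rabs_zero tendsto_ident_at)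
  qed
  then show ?thesis using equal by (simp add: DERIV_def)
qed

lemma cutoff_has_derivative:
  assumes "norm x < 1"
  shows "((\<lambda>t. (cutoff_base k (x + t *\<^sub>R axis i 1))\<^sup>2) has_real_derivative cutoff_grad k x i) (at 0)"
proof -
  let ?u = "\<lambda>t. 1 - ((norm (x + t *\<^sub>R axis i 1))\<^sup>2 :: real)"
  \<comment> \<open>Along a coordinate line \<open>1 - |x|\<^sup>2\<close> is a quadratic polynomial
    in \<open>t\<close>, so its derivative at 0 can be read off.\<close>
  have u: "?u t = 1 - (norm x)\<^sup>2 - 2 * t * x $ i - t\<^sup>2" for t
    unfolding power2_norm_eq_inner
    by (simp add: inner_add_left inner_add_right inner_axis inner_axis' power2_eq_square
        algebra_simps)
  have pos: "?u 0 > 0" using one_minus_norm_sq_pos[OF assms] by simp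
  have du: "(?u has_real_derivative - 2 * x $ i) (at 0)"
    unfolding u by (auto intro!: derivative_eq_intros)
  have dv: "((\<lambda>t. 1 + ln (?u t) / real k) has_real_derivative
      (- 2 * x $ i) / (?u 0) / real k) (at 0)"
    using DERIV_add[OF DERIV_const DERIV_cdivide[OF DERIV_chain2[OF DERIV_ln_divide[OF pos] du]]] by simp
  have "((\<lambda>t. (max 0 (1 + ln (?u t) / real k))\<^sup>2) has_real_derivative
      2 * max 0 (1 + ln (?u 0) / real k) * ((- 2 * x $ i) / (?u 0) / real k)) (at 0)"
    by (rule DERIV_chain2[OF has_real_derivative_square_positive_part dv])
  moreover have "2 * max 0 (1 + ln (?u 0) / real k) * ((- 2 * x $ i) / (?u 0) / real k) = cutoff_grad k x i"
    using assms by (simp add: cutoff_grad_def cutoff_base_def mult_ac)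
  ultimately have *: "((\<lambda>t. (max 0 (1 + ln (?u t) / real k))\<^sup>2) has_real_derivative cutoff_grad k x i) (at 0)"
    by simp
  \<comment> \<open>For small \<open>t\<close> the line stays in the ball, where
    \<open>cutoff_base\<close> is given by its first branch.\<close>
  have "open ((\<lambda>t::real. x + t *\<^sub>R axis i (1::real)) -` ball 0 1)"
    by (intro open_vimage continuous_intros) auto
  then show ?thesis
    by (rule has_field_derivative_transform_within_open[OF *]) (use assms in \<open>auto simp: cutoff_base_def\<close>)
qed

text \<open>\<open>D\<close> is the derivative of the squared cutoff times \<open>F\<close>. The
  cutoff is zero near the unit sphere and beyond, so this product is differentiable everywhere with
  compact support, whatever \<open>F\<close> does outside the ball.\<close>

lemma cutoff_divergence:
  fixes F :: "real^'n::finite \<Rightarrow> real" and i :: 'n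
  assumes F: "smooth_fun (ball 0 1) F" and k: "0 < k"
  defines "D \<equiv> \<lambda>x. cutoff_grad k x i * F x + (cutoff_base k x)\<^sup>2 * partial i F x"
  shows "integrable lborel D" "(\<integral>x. D x \<partial>lborel) = 0"
proof -
  from cutoff_base_support[OF k, where 'a = "real^'n"] obtain r
    where r: "0 \<le> r" "r < 1" "\<And>x::real^'n. norm x > r \<Longrightarrow> cutoff_base k x = 0" by blast
  define G where "G x = (cutoff_base k x)\<^sup>2 * F x" for x
  have suppG: "G x = 0" and suppD: "D x = 0" if "norm x > r" for x
    using r(3)[OF that] by (simp_all add: G_def D_def cutoff_grad_def)
  have cF: "continuous_on (ball 0 1) F" "continuous_on (ball 0 1) (partial i F)"
    using F by (auto intro: smooth_fun_continuous_on smooth_fun_partial)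
  have cg: "continuous_on (ball 0 1) (\<lambda>x::real^'n. cutoff_grad k x i)"
    unfolding cutoff_grad_def using k
    by (intro continuous_intros continuous_on_cutoff_base) (use one_minus_norm_sq_pos in force)
  note cb = continuous_on_power[OF continuous_on_cutoff_base, of k 2]
  have contG: "continuous_on UNIV G"
    using continuous_on_mult[OF cb cF(1)] r(2) suppG
    unfolding G_def[symmetric] by (rule continuous_extend_by_zero)
  have contD: "continuous_on UNIV D"
    using continuous_on_add[OF continuous_on_mult[OF cg cF(1)] continuous_on_mult[OF cb cF(2)]] r(2) suppD
    unfolding D_def[symmetric] by (rule continuous_extend_by_zero)
  have "((\<lambda>t. G (x + t *\<^sub>R axis i 1)) has_real_derivative D x) (at 0)" for x
  proof (cases "norm x < 1")
    case True
    then show ?thesis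
      using DERIV_mult[OF cutoff_has_derivative[OF True]
          has_real_derivative_partial[OF smooth_fun_differentiable[OF F]]]
      unfolding G_def D_def by (simp add: mult.commute)
  next
    case False
    \<comment> \<open>Outside the unit ball the point lies in an open set on which \<open>G\<close>
      is identically zero.\<close>
    then have "x \<in> - cball 0 r" using r by simp
    moreover have "open ((\<lambda>t::real. x + t *\<^sub>R axis i (1::real)) -` (- cball 0 r))"
      by (intro open_vimage continuous_intros) auto
    moreover have "D x = 0" using suppD False r by simp
    moreover have "((\<lambda>_. 0) has_real_derivative 0) (at 0)"
      by (rule DERIV_const)
    ultimately show ?thesis
      using suppG
      by (auto intro: has_field_derivative_transform_within_open
          [of "\<lambda>_. 0" _ 0 "(\<lambda>t::real. x + t *\<^sub>R axis i (1::real)) -` (- cball 0 r)"])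
  qed
  from integral_directional_derivative_eq_0[OF this contG contD suppG suppD]
  show "(\<integral>x. D x \<partial>lborel) = 0" .
  show "integrable lborel D"
    by (rule integrable_continuous_compact_support[OF contD suppD])
qed

text \<open>In the integrated bound the first two terms form the divergence of the squared cutoff
  times \<open>F\<close>, whose integral is 0. The weighted integral of \<open>q\<close> is thus at
  most a constant over \<open>k\<close>; since the cutoffs increase with \<open>k\<close>, it is 0
  for each of them.\<close>

lemma vanishing_by_cutoff:
  fixes F :: "'n::finite \<Rightarrow> real^'n \<Rightarrow> real"
  assumes F: "\<And>i. smooth_fun (ball 0 1) (F i)"
    and q: "continuous_on (ball 0 1) q" "\<And>x. x \<in> ball 0 1 \<Longrightarrow> 0 \<le> q x"
    and E: "integrable lborel E" and C: "0 \<le> C"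
    and supp: "\<And>x. x \<notin> ball 0 1 \<Longrightarrow> E x = 0"
    and bound: "\<And>k x. 0 < k \<Longrightarrow> x \<in> ball 0 1 \<Longrightarrow>
      (cutoff_base k x)\<^sup>2 * q x \<le> (\<Sum>i\<in>UNIV. cutoff_grad k x i * F i x)
        + (cutoff_base k x)\<^sup>2 * (\<Sum>i\<in>UNIV. partial i (F i) x) + C / real k * E x"
    and x: "x \<in> ball 0 1"
  shows "q x = 0"
proof (rule ccontr)
  assume "q x \<noteq> 0"
  define W where "W k y = (cutoff_base k y)\<^sup>2 * q y" for k and y :: "real^'n"
  have Wc: "continuous_on UNIV (W k)" "integrable lborel (W k)" if k: "0 < k" for k
  proof -
    from cutoff_base_support[OF k, where 'a = "real^'n"] obtain r
      where r: "0 \<le> r" "r < 1" "\<And>x::real^'n. norm x > r \<Longrightarrow> cutoff_base k x = 0" by blast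
    have supp: "W k y = 0" if "norm y > r" for y
      using r(3)[OF that] by (simp add: W_def)
    have "continuous_on (ball 0 1) (W k)"
      unfolding W_def by (intro continuous_intros continuous_on_cutoff_base q(1))
    then show "continuous_on UNIV (W k)"
      using r(2) supp by (rule continuous_extend_by_zero)
    then show "integrable lborel (W k)"
      using supp by (rule integrable_continuous_compact_support)
  qed
  have W0: "W k y \<ge> 0" for k y
    using q(2)[of y] by (cases "norm y < 1") (auto simp: W_def cutoff_base_def)
  have intW: "(\<integral>y. W k y \<partial>lborel) \<le> C / real k * (\<integral>y. E y \<partial>lborel)" if k: "0 < k" for k
  proof -
    let ?D = "\<lambda>i y. cutoff_grad k y i * F i y + (cutoff_base k y)\<^sup>2 * partial i (F i) y"
    have D: "integrable lborel (?D i)" "(\<integral>y. ?D i y \<partial>lborel) = 0" for i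
      using cutoff_divergence[OF F k] by auto
    have "(\<integral>y. W k y \<partial>lborel) \<le> (\<integral>y. (\<Sum>i\<in>UNIV. ?D i y) + C / real k * E y \<partial>lborel)"
    proof (rule integral_mono)
      show "integrable lborel (W k)" using Wc k by simp
      show "integrable lborel (\<lambda>y. (\<Sum>i\<in>UNIV. ?D i y) + C / real k * E y)"
        by (rule Bochner_Integration.integrable_add[OF Bochner_Integration.integrable_sum[OF D(1)]
              integrable_mult_right[OF E]])
      show "W k y \<le> (\<Sum>i\<in>UNIV. ?D i y) + C / real k * E y" for y
      proof (cases "y \<in> ball 0 1")
        case True
        then show ?thesis using bound[OF k True]
          by (simp add: W_def sum.distrib sum_distrib_left)
      next
        case False
        then have "cutoff_base k y = 0" by (simp add: cutoff_base_def)
        then show ?thesis using supp[OF False] by (simp add: W_def cutoff_grad_def)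
      qed
    qed
    also have "\<dots> = (\<integral>y. (\<Sum>i\<in>UNIV. ?D i y) \<partial>lborel) + (\<integral>y. C / real k * E y \<partial>lborel)"
      by (rule Bochner_Integration.integral_add[OF Bochner_Integration.integrable_sum[OF D(1)]
            integrable_mult_right[OF E]])
    also have "\<dots> = C / real k * (\<integral>y. E y \<partial>lborel)"
      unfolding Bochner_Integration.integral_sum[OF D(1)] D(2) by simp
    finally show ?thesis .
  qed
  \<comment> \<open>\<open>k0\<close> is large enough that the cutoff is positive at
    \<open>x\<close>; the successor in the witness keeps it nonzero.\<close>
  obtain k0 :: nat where k0: "k0 > 0" "- ln (1 - (norm x)\<^sup>2) < real k0"
  proof -
    obtain m :: nat where "- ln (1 - (norm x)\<^sup>2) < real m" using reals_Archimedean2 by blast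
    then show ?thesis by (intro that[of "Suc m"]) auto
  qed
  have "1 + ln (1 - (norm x)\<^sup>2) / real k0 > 0"
    using k0 by (simp add: field_simps)
  then have "cutoff_base k0 x > 0" using x by (simp add: cutoff_base_def)
  then have Wx: "W k0 x \<noteq> 0" using \<open>q x \<noteq> 0\<close> by (simp add: W_def)
  \<comment> \<open>The cutoff on the left stays fixed while \<open>k\<close> on the right grows, so
    the limit bounds one and the same integral by 0.\<close>
  have "(\<integral>y. W k0 y \<partial>lborel) \<le> C * (\<integral>y. E y \<partial>lborel) * inverse (real k)" if "k \<ge> k0" for k
  proof -
    have "W k0 y \<le> W k y" for y
      using q(2)[of y] cutoff_base_mono[OF k0(1) that, of y] cutoff_base_range[of k0 y]
      by (cases "norm y < 1") (auto simp: W_def cutoff_base_def intro!: mult_right_mono power_mono)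
    then have "(\<integral>y. W k0 y \<partial>lborel) \<le> (\<integral>y. W k y \<partial>lborel)"
      using Wc k0(1) that by (intro integral_mono) auto
    also have "\<dots> \<le> C / real k * (\<integral>y. E y \<partial>lborel)"
      using intW k0(1) that by simp
    finally show ?thesis by (simp add: divide_inverse mult_ac)
  qed
  moreover have "(\<lambda>k. C * (\<integral>y. E y \<partial>lborel) * inverse (real k)) \<longlonglongrightarrow> C * (\<integral>y. E y \<partial>lborel) * 0"
    by (intro tendsto_intros lim_inverse_n)
  ultimately have "(\<integral>y. W k0 y \<partial>lborel) \<le> 0"
    using LIMSEQ_le_const[of _ "C * (\<integral>y. E y \<partial>lborel) * 0"] by auto
  then show False
    using vanishing_if_integral_nonpos[OF Wc[OF k0(1)] W0] Wx by blast
qed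

section \<open>Square-integrable harmonic forms on the ball\<close>

text \<open>The boundary defining function of the ball: the hyperbolic metric is \<open>(2 / bdf)\<^sup>2\<close> times
  the Euclidean one.\<close>

definition bdf :: "real^'n::finite \<Rightarrow> real" where
  "bdf x = 1 - (norm x)\<^sup>2"

lemma norm_sq_eq_sum: "(norm (x::real^'n::finite))\<^sup>2 = (\<Sum>i\<in>UNIV. (x $ i)\<^sup>2)"
  by (simp add: norm_vec_def L2_set_def sum_nonneg)

lemma bdf_pos: "x \<in> ball 0 1 \<Longrightarrow> 0 < bdf x"
  using one_minus_norm_sq_pos[of x] by (auto simp: bdf_def)

lemma bdf_nonzero: "x \<in> ball 0 1 \<Longrightarrow> bdf x \<noteq> 0"
  using bdf_pos[of x] by linarith

lemma smooth_bdf: "open U \<Longrightarrow> smooth_fun U bdf"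
  unfolding bdf_def[abs_def] norm_sq_eq_sum
  by (intro smooth_fun_diff smooth_fun_const smooth_fun_sum smooth_fun_power smooth_fun_coord)

lemma differentiable_coord [simp]: "(\<lambda>x. x $ j) differentiable at (x :: real^'n::finite)"
  by (rule bounded_linear_imp_differentiable) (rule bounded_linear_vec_nth)

lemma differentiable_bdf [simp]: "bdf differentiable at x"
  using smooth_fun_differentiable[OF smooth_bdf[OF open_UNIV]] by simp

lemma partial_bdf: "partial i bdf x = - 2 * x $ i"
proof -
  have "partial i bdf x = partial i (\<lambda>x. 1 - (\<Sum>j\<in>UNIV. (x $ j)\<^sup>2)) x"
    by (simp add: bdf_def[abs_def] norm_sq_eq_sum)
  also have "\<dots> = - (\<Sum>j\<in>UNIV. 2 * x $ j * (if i = j then 1 else 0))"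
    by (subst partial_diff) (auto simp: partial_sum partial_power partial_coord)
  also have "\<dots> = - (\<Sum>j\<in>UNIV. if i = j then 2 * x $ j else 0)"
    by (intro arg_cong[of _ _ uminus] sum.cong) auto
  also have "\<dots> = - 2 * x $ i" by simp
  finally show ?thesis .
qed

lemma smooth_inverse_bdf: "smooth_fun (ball 0 1) (\<lambda>x. inverse (bdf x))"
  by (intro smooth_fun_inverse smooth_bdf open_ball) (rule bdf_nonzero)

lemma smooth_weight: "smooth_fun (ball 0 1) (\<lambda>x. (2 / bdf x) ^ m)"
  unfolding divide_inverse
  by (intro smooth_fun_power smooth_fun_mult smooth_fun_const smooth_inverse_bdf open_ball)

lemma partial_weight:
  assumes "x \<in> ball 0 1"
  shows "partial i (\<lambda>y. (2 / bdf y) ^ m) x = 2 * real m * x $ i * (2 / bdf x) ^ m / bdf x"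
proof -
  have d: "(\<lambda>y. inverse (bdf y)) differentiable at x" 
    using smooth_inverse_bdf assms by (rule smooth_fun_differentiable)
  have "partial i (\<lambda>y. 2 / bdf y) x = 4 * x $ i / (bdf x)\<^sup>2"
    using partial_cmult[OF d, of i 2] partial_inverse[OF differentiable_bdf bdf_nonzero[OF assms], of i]
    by (simp add: divide_inverse partial_bdf power2_eq_square)
  then show ?thesis
    using partial_power[of "\<lambda>y. 2 / bdf y" x i m] bdf_nonzero[OF assms] d
    \<comment> \<open>The power rule contains \<open>m - 1\<close>, which is truncated at
      \<open>m = 0\<close>.\<close>
    by (cases m) (auto simp: divide_inverse power2_eq_square)
qed

section \<open>Vanishing theorems for weighted forms\<close>

lemma cutoff_grad_bdf: "cutoff_grad k x i = - (cutoff_base k x * (4 * x $ i / (real k * bdf x)))"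
  by (simp add: cutoff_grad_def bdf_def)

text \<open>A Caccioppoli argument. Here \<open>B\<close> is the exterior derivative of
  \<open>a\<close>, and \<open>F\<close> pairs \<open>a\<close> with the weighted \<open>B\<close>.
  By the coclosedness of \<open>B\<close> the divergence of \<open>F\<close> is half the weighted
  square of \<open>B\<close>; the gradient of the cutoff costs half of this and an error of order
  \<open>1/k\<close>.\<close>

lemma coclosed_d_imp_closed:
  fixes a :: "'n::finite \<Rightarrow> real^'n \<Rightarrow> real" and W :: "real^'n \<Rightarrow> real"
  defines "B \<equiv> \<lambda>i j x. partial i (a j) x - partial j (a i) x"
  assumes a: "\<And>i. smooth_fun (ball 0 1) (a i)" and W: "smooth_fun (ball 0 1) W"
    and W0: "\<And>x. x \<in> ball 0 1 \<Longrightarrow> 0 < W x"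
    and coclosed: "\<And>j x. x \<in> ball 0 1 \<Longrightarrow> (\<Sum>i\<in>UNIV. partial i (\<lambda>y. W y * B i j y) x) = 0"
    and E: "integrable lborel (\<lambda>x. indicator (ball 0 1) x * (4 * W x / (bdf x)\<^sup>2 * (\<Sum>i\<in>UNIV. (a i x)\<^sup>2)))"
    and x: "x \<in> ball 0 1"
  shows "partial i (a j) x = partial j (a i) x"
proof -
  have sB: "smooth_fun (ball 0 1) (B i j)" for i j
    unfolding B_def by (intro smooth_fun_diff smooth_fun_partial a open_ball)
  have sWB: "smooth_fun (ball 0 1) (\<lambda>y. W y * B i j y)" for i j
    by (intro smooth_fun_mult sB W open_ball)
  define F where "F i x = (\<Sum>j\<in>UNIV. a j x * (W x * B i j x))" for i x
  have sF: "smooth_fun (ball 0 1) (F i)" for i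
    unfolding F_def by (intro smooth_fun_sum smooth_fun_mult[OF _ a sWB] open_ball)
  define S where "S x = (\<Sum>i\<in>UNIV. \<Sum>j\<in>UNIV. (B i j x)\<^sup>2)" for x
  have sS: "smooth_fun (ball 0 1) S"
    unfolding S_def by (intro smooth_fun_sum smooth_fun_power sB open_ball)
  have div: "(\<Sum>i\<in>UNIV. partial i (F i) x) = W x * S x / 2" if x: "x \<in> ball 0 1" for x
  proof -
    have "(\<Sum>i\<in>UNIV. partial i (F i) x) =
        (\<Sum>i\<in>UNIV. \<Sum>j\<in>UNIV. a j x * partial i (\<lambda>y. W y * B i j y) x + partial i (a j) x * (W x * B i j x))"
      unfolding F_def using smooth_fun_differentiable[OF a x] smooth_fun_differentiable[OF sWB x]
      by (subst partial_sum) (auto simp: partial_mult intro!: differentiable_mult)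
    also have "\<dots> = (\<Sum>j\<in>UNIV. a j x * (\<Sum>i\<in>UNIV. partial i (\<lambda>y. W y * B i j y) x))
        + (\<Sum>i\<in>UNIV. \<Sum>j\<in>UNIV. partial i (a j) x * (W x * B i j x))"
      by (simp add: sum.distrib sum_distrib_left) (rule sum.swap)
    also have "\<dots> = (\<Sum>i\<in>UNIV. \<Sum>j\<in>UNIV. partial i (a j) x * (W x * B i j x))"
      using coclosed[OF x] by simp
    finally have *: "(\<Sum>i\<in>UNIV. partial i (F i) x) = (\<Sum>i\<in>UNIV. \<Sum>j\<in>UNIV. partial i (a j) x * (W x * B i j x))" .
    \<comment> \<open>Exchanging the indices and using the antisymmetry of \<open>B\<close> replaces
      one derivative of \<open>a\<close> by half of \<open>B\<close>.\<close>
    have "(\<Sum>i\<in>UNIV. \<Sum>j\<in>UNIV. partial i (a j) x * (W x * B i j x))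
        = (\<Sum>i\<in>UNIV. \<Sum>j\<in>UNIV. partial j (a i) x * (W x * B j i x))"
      by (rule sum.swap)
    also have "\<dots> = (\<Sum>i\<in>UNIV. \<Sum>j\<in>UNIV. - partial j (a i) x * (W x * B i j x))"
      by (intro sum.cong refl) (simp add: B_def algebra_simps)
    finally have "2 * (\<Sum>i\<in>UNIV. partial i (F i) x)
       = (\<Sum>i\<in>UNIV. \<Sum>j\<in>UNIV. partial i (a j) x * (W x * B i j x) + - partial j (a i) x * (W x * B i j x))"
      unfolding sum.distrib using * by simp
    also have "\<dots> = W x * S x"
      unfolding S_def sum_distrib_left
      by (intro sum.cong refl) (simp add: B_def power2_eq_square algebra_simps)
    finally show ?thesis by simp
  qed
  let ?E = "\<lambda>x. indicator (ball 0 1) x * (4 * W x / (bdf x)\<^sup>2 * (\<Sum>i\<in>UNIV. (a i x)\<^sup>2))"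
  have "W x * S x / 4 = 0"
  proof (rule vanishing_by_cutoff[where F = F and E = ?E and C = 4, OF sF _ _ E _ _ _ x])
    show "continuous_on (ball 0 1) (\<lambda>x. W x * S x / 4)"
      using smooth_fun_continuous_on[OF W] smooth_fun_continuous_on[OF sS]
      by (intro continuous_intros) auto
    show "0 \<le> W x * S x / 4" if "x \<in> ball 0 1" for x
      using W0[OF that] by (auto simp: S_def intro!: mult_nonneg_nonneg sum_nonneg)
    fix k :: nat and x :: "real^'n"
    assume k: "0 < k" and x: "x \<in> ball 0 1"
    let ?c = "cutoff_base k x" and ?t = "\<lambda>i. 4 * x $ i / (real k * bdf x)"
    let ?A = "\<Sum>i\<in>UNIV. (a i x)\<^sup>2"
    \<comment> \<open>The square is weighted so that its mixed term is the cutoff gradient times a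
      summand of \<open>F\<close>, and its \<open>B\<close> term, summed over both indices, is half
      of what the divergence supplies.\<close>
    have "0 \<le> W x * (?c * B i j x / 2 - ?t i * a j x)\<^sup>2" for i j
      using W0[OF x] by simp
    moreover have "W x * (?c * B i j x / 2 - ?t i * a j x)\<^sup>2 =
       cutoff_grad k x i * (a j x * (W x * B i j x)) + ?c\<^sup>2 / 4 * W x * (B i j x)\<^sup>2 + W x * ((?t i)\<^sup>2 * (a j x)\<^sup>2)"
      for i j
      unfolding cutoff_grad_bdf power2_eq_square by (simp add: algebra_simps)
    ultimately have "0 \<le> (\<Sum>i\<in>UNIV. \<Sum>j\<in>UNIV. cutoff_grad k x i * (a j x * (W x * B i j x))
        + ?c\<^sup>2 / 4 * W x * (B i j x)\<^sup>2 + W x * ((?t i)\<^sup>2 * (a j x)\<^sup>2))"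
      by (intro sum_nonneg) simp
    also have "\<dots> = (\<Sum>i\<in>UNIV. cutoff_grad k x i * F i x) + ?c\<^sup>2 / 4 * W x * S x
        + W x * ((\<Sum>i\<in>UNIV. (?t i)\<^sup>2) * ?A)"
      unfolding F_def S_def sum.distrib sum_product by (simp add: sum_distrib_left)
    finally have 1: "0 \<le> (\<Sum>i\<in>UNIV. cutoff_grad k x i * F i x) + ?c\<^sup>2 / 4 * W x * S x
        + W x * ((\<Sum>i\<in>UNIV. (?t i)\<^sup>2) * ?A)" .
    have "(\<Sum>i\<in>UNIV. (?t i)\<^sup>2) = 16 * (norm x)\<^sup>2 / ((real k)\<^sup>2 * (bdf x)\<^sup>2)"
      unfolding norm_sq_eq_sum by (simp add: power_divide power_mult_distrib sum_distrib_left sum_divide_distrib)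
    \<comment> \<open>Since \<open>|x| < 1 \<le> k\<close>, the factor
      \<open>|x|\<^sup>2 / k\<^sup>2\<close> is at most \<open>1 / k\<close>.\<close>
    also have "\<dots> \<le> 16 / (real k * (bdf x)\<^sup>2)"
    proof -
      have "(norm x)\<^sup>2 * real k \<le> 1 * (real k)\<^sup>2"
        unfolding power2_eq_square[of "real k"] mult.assoc[symmetric]
        using x k one_minus_norm_sq_pos[of x]
        by (intro mult_right_mono) (auto intro: order_trans[of _ 1])
      then show ?thesis using k bdf_pos[OF x]
        by (simp add: field_simps power2_eq_square)
    qed
    finally have "W x * ((\<Sum>i\<in>UNIV. (?t i)\<^sup>2) * ?A) \<le> W x * (16 / (real k * (bdf x)\<^sup>2) * ?A)"
      using W0[OF x] by (intro mult_left_mono mult_right_mono sum_nonneg) auto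
    also have "\<dots> = 4 / real k * ?E x"
      using x by simp
    finally have 2: "W x * ((\<Sum>i\<in>UNIV. (?t i)\<^sup>2) * ?A) \<le> 4 / real k * ?E x" .
    show "?c\<^sup>2 * (W x * S x / 4) \<le> (\<Sum>i\<in>UNIV. cutoff_grad k x i * F i x)
        + ?c\<^sup>2 * (\<Sum>i\<in>UNIV. partial i (F i) x) + 4 / real k * ?E x"
    proof -
      have "?c\<^sup>2 * (W x * S x / 4) = ?c\<^sup>2 / 4 * W x * S x" "?c\<^sup>2 * (W x * S x / 2) = 2 * (?c\<^sup>2 / 4 * W x * S x)"
        by simp_all
      with 1 2 show ?thesis unfolding div[OF x] by linarith
    qed
  qed auto
  then have "S x = 0" using W0[OF x] by simp
  then have "(B i j x)\<^sup>2 = 0"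
    unfolding S_def by (simp add: sum_nonneg_eq_0_iff sum_nonneg)
  then show ?thesis by (simp add: B_def)
qed

text \<open>The field \<open>F\<close> below is the stress-energy tensor of \<open>a\<close> contracted with the radial field
  \<open>(1 - |x|\<^sup>2) x\<close>, which has bounded hyperbolic length.  In dimension \<open>m + 2 > 2\<close> its
  divergence is positive definite in \<open>a\<close>.\<close>

lemma L2_closed_coclosed_imp_zero:
  fixes a :: "'n::finite \<Rightarrow> real^'n \<Rightarrow> real"
  defines "m \<equiv> CARD('n) - 2"
  defines "W \<equiv> \<lambda>x. (2 / bdf x) ^ m"
  assumes n: "CARD('n) > 2"
    and a: "\<And>i. smooth_fun (ball 0 1) (a i)"
    and closed: "\<And>i j x. x \<in> ball 0 1 \<Longrightarrow> partial i (a j) x = partial j (a i) x"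
    and coclosed: "\<And>x. x \<in> ball 0 1 \<Longrightarrow> (\<Sum>i\<in>UNIV. partial i (\<lambda>y. W y * a i y) x) = 0"
    and E: "integrable lborel (\<lambda>x. indicator (ball 0 1) x * (W x * (\<Sum>i\<in>UNIV. (a i x)\<^sup>2)))"
    and x: "x \<in> ball 0 1"
  shows "a i x = 0"
proof -
  have m: "1 \<le> real m" and card: "real (CARD('n)) = real m + 2"
    using n by (auto simp: m_def)
  define A where "A x = (\<Sum>j\<in>UNIV. a j x * a j x)" for x
  define P where "P x = (\<Sum>j\<in>UNIV. x $ j * a j x)" for x
  have A_eq: "A x = (\<Sum>i\<in>UNIV. (a i x)\<^sup>2)" for x
    by (simp add: A_def power2_eq_square)
  have A0: "0 \<le> A x" for x
    unfolding A_eq by (intro sum_nonneg) auto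
  have sW: "smooth_fun (ball 0 1) W" unfolding W_def by (rule smooth_weight)
  have W0: "0 < W x" if "x \<in> ball 0 1" for x
    using bdf_pos[OF that] by (simp add: W_def)
  have sA: "smooth_fun (ball 0 1) A" and sP: "smooth_fun (ball 0 1) P"
    unfolding A_def P_def by (intro smooth_fun_sum smooth_fun_mult smooth_fun_coord a open_ball)+
  have sY: "smooth_fun (ball 0 1) (\<lambda>x. W x * (bdf x * x $ i))" for i
    by (intro smooth_fun_mult sW smooth_bdf smooth_fun_coord open_ball)
  have sAY: "smooth_fun (ball 0 1) (\<lambda>x. A x * (W x * (bdf x * x $ i)))" for i
    by (intro smooth_fun_mult[OF _ sA sY] open_ball)
  have sWa: "smooth_fun (ball 0 1) (\<lambda>x. W x * a i x)" for i
    by (intro smooth_fun_mult sW a open_ball)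
  have sbP: "smooth_fun (ball 0 1) (\<lambda>x. bdf x * P x)"
    by (intro smooth_fun_mult smooth_bdf sP open_ball)
  have sWabP: "smooth_fun (ball 0 1) (\<lambda>x. (W x * a i x) * (bdf x * P x))" for i
    by (intro smooth_fun_mult[OF _ sWa sbP] open_ball)
  define F where "F i x = 1/2 * (A x * (W x * (bdf x * x $ i))) - (W x * a i x) * (bdf x * P x)" for i x
  have sF: "smooth_fun (ball 0 1) (F i)" for i
    unfolding F_def by (intro smooth_fun_diff smooth_fun_mult[OF _ smooth_fun_const sAY] sWabP open_ball)
  have div: "(\<Sum>i\<in>UNIV. partial i (F i) x)
      = W x * A x * ((real m - 1) * (norm x)\<^sup>2 + real m / 2 * bdf x) + 2 * W x * (P x)\<^sup>2"
    if x: "x \<in> ball 0 1" for x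
  proof -
    note diff = smooth_fun_differentiable[OF _ x]
    \<comment> \<open>Differentiating the weight contributes \<open>2 * m\<close>, differentiating
      \<open>bdf\<close> contributes \<open>-2\<close>; summation over \<open>i\<close> later gives
      \<open>(2m - 2) |x|\<^sup>2 + (m + 2) bdf x\<close>.\<close>
    have pY: "partial i (\<lambda>x. W x * (bdf x * x $ i)) x = W x * ((2 * real m - 2) * (x $ i)\<^sup>2 + bdf x)" for i
    proof -
      have "partial i (\<lambda>x. W x * (bdf x * x $ i)) x
          = W x * (bdf x * 1 + - 2 * x $ i * x $ i) + 2 * real m * x $ i * W x / bdf x * (bdf x * x $ i)"
        using diff[OF sW] partial_weight[OF x, of i m]
        by (simp add: partial_mult partial_bdf partial_coord W_def)
      then show ?thesis using bdf_nonzero[OF x] by (simp add: algebra_simps power2_eq_square)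
    qed
    have pA: "partial i A x = 2 * (\<Sum>j\<in>UNIV. a j x * partial i (a j) x)" for i
      unfolding A_def using diff[OF a]
      by (subst partial_sum) (auto simp: partial_mult sum_distrib_left mult_ac intro!: sum.cong)
    have pP: "partial i P x = a i x + (\<Sum>j\<in>UNIV. x $ j * partial i (a j) x)" for i
    proof -
      have "partial i P x = (\<Sum>j\<in>UNIV. x $ j * partial i (a j) x + (if i = j then a j x else 0))"
        unfolding P_def using diff[OF a]
        by (subst partial_sum) (auto simp: partial_mult partial_coord intro!: sum.cong)
      then show ?thesis by (simp add: sum.distrib)
    qed
    have pbP: "partial i (\<lambda>x. bdf x * P x) x
       = bdf x * (a i x + (\<Sum>j\<in>UNIV. x $ j * partial i (a j) x)) - 2 * x $ i * P x" for i
      using diff[OF sP] by (simp add: partial_mult partial_bdf pP)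
    have "partial i (F i) x = 1/2 * (A x * (W x * ((2 * real m - 2) * (x $ i)\<^sup>2 + bdf x)))
         + (\<Sum>j\<in>UNIV. a j x * partial i (a j) x) * (W x * (bdf x * x $ i))
       - (W x * a i x) * (bdf x * (a i x + (\<Sum>j\<in>UNIV. x $ j * partial i (a j) x)) - 2 * x $ i * P x)
       - partial i (\<lambda>y. W y * a i y) x * (bdf x * P x)" for i
    proof -
      have "partial i (F i) x = 1/2 * partial i (\<lambda>x. A x * (W x * (bdf x * x $ i))) x
          - partial i (\<lambda>x. (W x * a i x) * (bdf x * P x)) x"
        unfolding F_def partial_diff[OF diff[OF smooth_fun_mult[OF open_ball smooth_fun_const[OF open_ball] sAY]]
            diff[OF sWabP]]
          partial_cmult[OF diff[OF sAY]] ..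
      also have "partial i (\<lambda>x. A x * (W x * (bdf x * x $ i))) x =
          A x * (W x * ((2 * real m - 2) * (x $ i)\<^sup>2 + bdf x)) + partial i A x * (W x * (bdf x * x $ i))"
        using partial_mult[OF diff[OF sA] diff[OF sY]] pY by simp
      also have "partial i (\<lambda>x. (W x * a i x) * (bdf x * P x)) x =
          (W x * a i x) * (bdf x * (a i x + (\<Sum>j\<in>UNIV. x $ j * partial i (a j) x)) - 2 * x $ i * P x)
          + partial i (\<lambda>y. W y * a i y) x * (bdf x * P x)"
        using partial_mult[OF diff[OF sWa] diff[OF sbP]] pbP by simp
      finally show ?thesis unfolding pA by (simp add: algebra_simps)
    qed
    moreover have PP: "2 * W x * P x * P x = (\<Sum>i\<in>UNIV. 2 * W x * P x * (x $ i * a i x))"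
      unfolding sum_distrib_left[symmetric] P_def[symmetric] ..
    ultimately have "(\<Sum>i\<in>UNIV. partial i (F i) x) =
        (\<Sum>i\<in>UNIV. 1/2 * (A x * (W x * ((2 * real m - 2) * (x $ i)\<^sup>2 + bdf x))))
        + (\<Sum>i\<in>UNIV. (\<Sum>j\<in>UNIV. a j x * partial i (a j) x) * (W x * (bdf x * x $ i)))
        - (\<Sum>i\<in>UNIV. (W x * a i x) * (bdf x * (a i x + (\<Sum>j\<in>UNIV. x $ j * partial i (a j) x)) - 2 * x $ i * P x))
        - (\<Sum>i\<in>UNIV. partial i (\<lambda>y. W y * a i y) x * (bdf x * P x))"
      by (simp add: sum.distrib sum_subtractf)
    also have "(\<Sum>i\<in>UNIV. partial i (\<lambda>y. W y * a i y) x * (bdf x * P x)) = 0"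
      using coclosed[OF x] by (simp flip: sum_distrib_right)
    also have "(\<Sum>i\<in>UNIV. 1/2 * (A x * (W x * ((2 * real m - 2) * (x $ i)\<^sup>2 + bdf x))))
        = 1/2 * (A x * (W x * ((2 * real m - 2) * (norm x)\<^sup>2 + (real m + 2) * bdf x)))"
      unfolding norm_sq_eq_sum card[symmetric] sum_distrib_left[symmetric] sum.distrib by simp
    also have "(\<Sum>i\<in>UNIV. (\<Sum>j\<in>UNIV. a j x * partial i (a j) x) * (W x * (bdf x * x $ i)))
        = W x * bdf x * (\<Sum>i\<in>UNIV. \<Sum>j\<in>UNIV. x $ i * a j x * partial i (a j) x)"
      by (simp add: sum_distrib_left sum_distrib_right mult_ac)
    \<comment> \<open>Closedness identifies the derivative of \<open>A\<close> along
      \<open>x\<close> with the term coming from the derivative of \<open>P\<close>. The two cancel,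
      and what is left of the divergence contains no derivatives of \<open>a\<close>.\<close>
    also have "(\<Sum>i\<in>UNIV. \<Sum>j\<in>UNIV. x $ i * a j x * partial i (a j) x)
        = (\<Sum>i\<in>UNIV. a i x * (\<Sum>j\<in>UNIV. x $ j * partial i (a j) x))"
      by (subst sum.swap) (use closed[OF x] in \<open>simp add: sum_distrib_left mult_ac\<close>)
    also have "(\<Sum>i\<in>UNIV. (W x * a i x) * (bdf x * (a i x + (\<Sum>j\<in>UNIV. x $ j * partial i (a j) x)) - 2 * x $ i * P x))
        = W x * bdf x * A x + W x * bdf x * (\<Sum>i\<in>UNIV. a i x * (\<Sum>j\<in>UNIV. x $ j * partial i (a j) x))
          - 2 * W x * P x * P x"
      unfolding A_def PP sum_distrib_left[of "W x * bdf x"] sum.distrib[symmetric] sum_subtractf[symmetric]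
      by (intro sum.cong refl) (simp add: algebra_simps)
    finally show ?thesis by (simp add: algebra_simps power2_eq_square)
  qed
  \<comment> \<open>The gradient of the cutoff is a multiple of \<open>x\<close>, so it meets only
    the radial component of \<open>F\<close>.\<close>
  have radial: "(\<Sum>i\<in>UNIV. x $ i * F i x) = W x * bdf x * (A x * (norm x)\<^sup>2 / 2 - (P x)\<^sup>2)" for x
  proof -
    have "(\<Sum>i\<in>UNIV. x $ i * F i x) = (\<Sum>i\<in>UNIV. W x * bdf x * (A x / 2) * (x $ i)\<^sup>2)
        - (\<Sum>i\<in>UNIV. W x * bdf x * P x * (x $ i * a i x))"
      unfolding F_def sum_subtractf[symmetric]
      by (intro sum.cong refl) (simp add: algebra_simps power2_eq_square)
    also have "\<dots> = W x * bdf x * (A x / 2) * (norm x)\<^sup>2 - W x * bdf x * P x * P x"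
      unfolding norm_sq_eq_sum P_def[of x] sum_distrib_left[symmetric] ..
    finally show ?thesis by (simp add: algebra_simps power2_eq_square)
  qed
  let ?E = "\<lambda>x. indicator (ball 0 1) x * (W x * A x)"
  have "W x * bdf x * A x / 2 = 0"
  proof (rule vanishing_by_cutoff[where F = F and E = ?E and C = 2, OF sF _ _ _ _ _ _ x])
    show "integrable lborel ?E" using E by (simp add: A_eq)
    show "continuous_on (ball 0 1) (\<lambda>x. W x * bdf x * A x / 2)"
      using smooth_fun_continuous_on[OF sW] smooth_fun_continuous_on[OF smooth_bdf[OF open_ball]]
        smooth_fun_continuous_on[OF sA]
      by (intro continuous_intros) auto
    show "0 \<le> W x * bdf x * A x / 2" if "x \<in> ball 0 1" for x
      using W0[OF that] bdf_pos[OF that] A0[of x] by simp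
    fix k :: nat and x :: "real^'n"
    assume k: "0 < k" and x: "x \<in> ball 0 1"
    let ?c = "cutoff_base k x"
    have "(\<Sum>i\<in>UNIV. cutoff_grad k x i * F i x) = - (4 * ?c / (real k * bdf x)) * (\<Sum>i\<in>UNIV. x $ i * F i x)"
      unfolding cutoff_grad_bdf sum_distrib_left by (intro sum.cong refl) simp
    also have "\<dots> = - (2 * ?c / real k * (W x * A x * (norm x)\<^sup>2)) + 4 * ?c / real k * (W x * (P x)\<^sup>2)"
      unfolding radial using bdf_nonzero[OF x] k by (simp add: field_simps)
    finally have g: "(\<Sum>i\<in>UNIV. cutoff_grad k x i * F i x)
        = - (2 * ?c / real k * (W x * A x * (norm x)\<^sup>2)) + 4 * ?c / real k * (W x * (P x)\<^sup>2)" .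
    \<comment> \<open>The part with \<open>P\<close> has a favourable sign and is dropped; the part
      with \<open>A\<close> has a factor \<open>1/k\<close> and goes into the error.\<close>
    have "0 \<le> 4 * ?c / real k * (W x * (P x)\<^sup>2)"
      using cutoff_base_range[of k x] W0[OF x] by simp
    moreover have "2 * ?c / real k * (W x * A x * (norm x)\<^sup>2) \<le> 2 * 1 / real k * (W x * A x * 1)"
      using cutoff_base_range[of k x] W0[OF x] A0[of x] bdf_pos[OF x]
      by (intro mult_mono divide_right_mono) (auto simp: bdf_def)
    ultimately have 1: "- (2 / real k * ?E x) \<le> (\<Sum>i\<in>UNIV. cutoff_grad k x i * F i x)"
      unfolding g using x by simp
    \<comment> \<open>This is the divergence minus \<open>W x * bdf x * A x / 2\<close>. Its
      coefficients are nonnegative because \<open>m \<ge> 1\<close>, which is the assumption on the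
      dimension.\<close>
    have "0 \<le> W x * A x * ((real m - 1) * (norm x)\<^sup>2 + (real m - 1) / 2 * bdf x) + 2 * W x * (P x)\<^sup>2"
      using m W0[OF x] A0[of x] bdf_pos[OF x]
      by (intro add_nonneg_nonneg mult_nonneg_nonneg) auto
    then have "W x * bdf x * A x / 2 \<le> (\<Sum>i\<in>UNIV. partial i (F i) x)"
      unfolding div[OF x] by (simp add: algebra_simps diff_divide_distrib)
    then have "?c\<^sup>2 * (W x * bdf x * A x / 2) \<le> ?c\<^sup>2 * (\<Sum>i\<in>UNIV. partial i (F i) x)"
      by (intro mult_left_mono) auto
    with 1 show "?c\<^sup>2 * (W x * bdf x * A x / 2) \<le> (\<Sum>i\<in>UNIV. cutoff_grad k x i * F i x)
        + ?c\<^sup>2 * (\<Sum>i\<in>UNIV. partial i (F i) x) + 2 / real k * ?E x"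
      by simp
  qed auto
  then have "(\<Sum>i\<in>UNIV. (a i x)\<^sup>2) = 0"
    using W0[OF x] bdf_nonzero[OF x] by (simp add: A_eq)
  then show ?thesis by (simp add: sum_nonneg_eq_0_iff)
qed

section \<open>The hyperbolic metric and its operators in ball coordinates\<close>

lemma matrix_inv_scalar:
  fixes c :: real
  assumes "c \<noteq> 0"
  shows "matrix_inv (c *\<^sub>R mat 1 :: real^'n::finite^'n) = inverse c *\<^sub>R mat 1"
proof -
  let ?A = "c *\<^sub>R mat 1 :: real^'n^'n" and ?B = "inverse c *\<^sub>R mat 1 :: real^'n^'n"
  have "?A ** ?B = mat 1" "?B ** ?A = mat 1"
    using assms by (simp_all flip: scalar_matrix_assoc add: matrix_scalar_ac)
  then show ?thesis
    \<comment> \<open>\<open>matrix_inv\<close> is a choice among two-sided inverses, so uniqueness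
      of such inverses identifies it.\<close>
    unfolding matrix_inv_def by (intro some_equality) (metis matrix_mul_assoc matrix_mul_lid matrix_mul_rid)+
qed

lemma hyp_metric_entry: "hyp_metric x $ i $ j = (if i = j then 4 / (bdf x)\<^sup>2 else 0)"
  by (simp add: hyp_metric_def bdf_def mat_def)

lemma ginv_hyp_entry:
  assumes "x \<in> ball 0 1"
  shows "ginv hyp_metric x $ i $ j = (if i = j then (bdf x)\<^sup>2 / 4 else 0)"
proof -
  have "4 / (bdf x)\<^sup>2 \<noteq> 0" using bdf_nonzero[OF assms] by simp
  from matrix_inv_scalar[OF this]
  have "ginv hyp_metric x = ((bdf x)\<^sup>2 / 4) *\<^sub>R mat 1"
    by (simp add: ginv_def hyp_metric_def flip: bdf_def)
  then show ?thesis by (simp add: mat_def)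
qed

lemma vol_density_hyp:
  fixes x :: "real^'n::finite"
  assumes "x \<in> ball 0 1"
  shows "vol_density hyp_metric x = (2 / bdf x) ^ CARD('n)"
proof -
  have "det (hyp_metric x) = (\<Prod>i\<in>(UNIV::'n set). hyp_metric x $ i $ i)"
    by (rule det_diagonal) (simp add: hyp_metric_entry)
  also have "\<dots> = ((2 / bdf x) ^ CARD('n))\<^sup>2"
  proof -
    have "4 / (bdf x)\<^sup>2 = (2 / bdf x)\<^sup>2" by (simp add: power_divide)
    then have "(\<Prod>i\<in>(UNIV::'n set). hyp_metric x $ i $ i) = ((2 / bdf x)\<^sup>2) ^ CARD('n)"
      by (simp only: hyp_metric_entry prod_constant if_True simp_thms)
    then show ?thesis
      unfolding power_mult[symmetric] by (simp add: mult.commute)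
  qed
  finally show ?thesis
    using bdf_pos[OF assms] by (simp add: vol_density_def)
qed

lemma flat_hyp: "flat hyp_metric v x $ i = 4 / (bdf x)\<^sup>2 * v x $ i"
  by (simp add: flat_def hyp_metric_entry if_distrib[of "\<lambda>c. c * _"] cong: if_cong)

lemma sharp_hyp: "x \<in> ball 0 1 \<Longrightarrow> sharp hyp_metric \<alpha> x $ i = (bdf x)\<^sup>2 / 4 * \<alpha> x $ i"
  by (simp add: sharp_def ginv_hyp_entry if_distrib[of "\<lambda>c. c * _"] cong: if_cong)

lemma rgrad_hyp: "x \<in> ball 0 1 \<Longrightarrow> rgrad hyp_metric p x $ i = (bdf x)\<^sup>2 / 4 * partial i p x"
  by (simp add: rgrad_def ginv_hyp_entry if_distrib[of "\<lambda>c. c * _"] cong: if_cong)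

lemma form_norm2_hyp:
  assumes "x \<in> ball 0 1"
  shows "form_norm2 hyp_metric \<alpha> x = (bdf x)\<^sup>2 / 4 * (\<Sum>i\<in>UNIV. (\<alpha> x $ i)\<^sup>2)"
proof -
  have "form_norm2 hyp_metric \<alpha> x
      = (\<Sum>i\<in>UNIV. \<Sum>j\<in>UNIV. if i = j then (bdf x)\<^sup>2 / 4 * (\<alpha> x $ j)\<^sup>2 else 0)"
    unfolding form_norm2_def ginv_hyp_entry[OF assms]
    by (intro sum.cong refl) (auto simp: power2_eq_square)
  then show ?thesis by (simp add: sum_distrib_left)
qed

lemma sharp_flat_hyp: "x \<in> ball 0 1 \<Longrightarrow> sharp hyp_metric (flat hyp_metric v) x = v x"
  using bdf_nonzero[of x] by (simp add: vec_eq_iff sharp_hyp flat_hyp)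

lemma smooth_conformal_factor: "smooth_fun (ball 0 1) (\<lambda>x. 4 / (bdf x)\<^sup>2)"
  using smooth_weight[of 2] by (simp add: power_divide)

lemma rdiv_hyp_eq_0_iff:
  fixes v :: "real^'n::finite \<Rightarrow> real^'n"
  assumes "x \<in> ball 0 1"
  shows "rdiv hyp_metric v x = 0 \<longleftrightarrow> (\<Sum>i\<in>UNIV. partial i (\<lambda>y. (2 / bdf y) ^ CARD('n) * v y $ i) x) = 0"
proof -
  have "partial i (\<lambda>y. vol_density hyp_metric y * v y $ i) x
      = partial i (\<lambda>y. (2 / bdf y) ^ CARD('n) * v y $ i) x" for i
    by (rule partial_cong[OF open_ball assms]) (simp add: vol_density_hyp)
  then show ?thesis
    using bdf_nonzero[OF assms] by (simp add: rdiv_def vol_density_hyp[OF assms])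
qed

lemma rdiv_cong_open:
  assumes "open U" "x \<in> U" "\<And>y. y \<in> U \<Longrightarrow> v y = w y"
  shows "rdiv g v x = rdiv g w x"
proof -
  have "partial i (\<lambda>y. vol_density g y * v y $ i) x = partial i (\<lambda>y. vol_density g y * w y $ i) x" for i
    by (rule partial_cong[OF assms(1,2)]) (simp add: assms(3))
  then show ?thesis by (simp add: rdiv_def)
qed

text \<open>The codifferential of the form is minus the divergence of \<open>v\<close>. It is zero
  on the whole open ball, hence so is its differential.\<close>

lemma hodge_laplacian_hyp_solenoidal:
  fixes v :: "real^'n::finite \<Rightarrow> real^'n"
  assumes "\<And>x. x \<in> ball 0 1 \<Longrightarrow> rdiv hyp_metric v x = 0" and x: "x \<in> ball 0 1"
  shows "hodge_laplacian1 hyp_metric (flat hyp_metric v) x = codiff2 hyp_metric (d1 (flat hyp_metric v)) x"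
proof -
  have "codiff1 hyp_metric (flat hyp_metric v) y = 0" if "y \<in> ball 0 1" for y
    using rdiv_cong_open[OF open_ball that sharp_flat_hyp] assms(1)[OF that]
    by (simp add: codiff1_def)
  then have "partial i (codiff1 hyp_metric (flat hyp_metric v)) x = partial i (\<lambda>_. 0) x" for i
    by (intro partial_cong[OF open_ball x])
  then show ?thesis by (simp add: hodge_laplacian1_def d0_def vec_eq_iff)
qed

text \<open>The inverse metric is diagonal, so raising two indices multiplies by the square of
  \<open>(bdf y)\<^sup>2 / 4\<close> and the double sum collapses.\<close>

lemma codiff2_hyp:
  fixes \<beta> :: "real^'n::finite \<Rightarrow> real^'n^'n"
  assumes x: "x \<in> ball 0 1"
  shows "codiff2 hyp_metric \<beta> x $ k = - (4 / (bdf x)\<^sup>2) * (1 / (2 / bdf x) ^ CARD('n)) *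
    (\<Sum>i\<in>UNIV. partial i (\<lambda>y. (2 / bdf y) ^ CARD('n) * ((bdf y)\<^sup>2 / 4)\<^sup>2 * \<beta> y $ i $ k) x)"
proof -
  have "partial i (\<lambda>y. vol_density hyp_metric y *
          (\<Sum>a\<in>UNIV. \<Sum>b\<in>UNIV. ginv hyp_metric y $ i $ a * ginv hyp_metric y $ j $ b * \<beta> y $ a $ b)) x
     = partial i (\<lambda>y. (2 / bdf y) ^ CARD('n) * ((bdf y)\<^sup>2 / 4)\<^sup>2 * \<beta> y $ i $ j) x" for i j
  proof (rule partial_cong[OF open_ball x])
    fix y :: "real^'n" assume y: "y \<in> ball 0 1"
    have "(\<Sum>a\<in>UNIV. \<Sum>b\<in>UNIV. ginv hyp_metric y $ i $ a * ginv hyp_metric y $ j $ b * \<beta> y $ a $ b)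
        = (\<Sum>a\<in>UNIV. if i = a then (\<Sum>b\<in>UNIV. if j = b then ((bdf y)\<^sup>2 / 4)\<^sup>2 * \<beta> y $ a $ b else 0) else 0)"
      unfolding ginv_hyp_entry[OF y] by (intro sum.cong refl) 
        (auto simp: power2_eq_square simp del: sum.delta sum.delta' intro!: sum.cong)
    then show "vol_density hyp_metric y *
          (\<Sum>a\<in>UNIV. \<Sum>b\<in>UNIV. ginv hyp_metric y $ i $ a * ginv hyp_metric y $ j $ b * \<beta> y $ a $ b)
        = (2 / bdf y) ^ CARD('n) * ((bdf y)\<^sup>2 / 4)\<^sup>2 * \<beta> y $ i $ j"
      by (simp add: vol_density_hyp[OF y])
  qed
  then have "codiff2 hyp_metric \<beta> x $ k = (\<Sum>j\<in>UNIV. if k = j then - (4 / (bdf x)\<^sup>2) * (1 / (2 / bdf x) ^ CARD('n)) *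
    (\<Sum>i\<in>UNIV. partial i (\<lambda>y. (2 / bdf y) ^ CARD('n) * ((bdf y)\<^sup>2 / 4)\<^sup>2 * \<beta> y $ i $ j) x) else 0)"
    unfolding codiff2_def vec_lambda_beta vol_density_hyp[OF x] hyp_metric_entry
    by (intro sum.cong refl) auto
  then show ?thesis by simp
qed

text \<open>Zero divergence makes \<alpha> coclosed and reduces the harmonic equation to \<delta> d
  \<alpha> = 0. The first vanishing theorem then gives closedness, the second gives \<alpha> =
  0.\<close>

lemma hyp_stationary_L2_harmonic_imp_zero:
  fixes v :: "real^'n::finite \<Rightarrow> real^'n"
  assumes n: "CARD('n) > 2" and v: "hyp_stationary_L2_harmonic v" and x: "x \<in> ball 0 1"
  shows "v x = 0"
proof -
  let ?\<alpha> = "flat hyp_metric v"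
  define a where "a i y = ?\<alpha> y $ i" for i y
  \<comment> \<open>The volume density with one index raised. \<open>W2\<close> below has two
    indices raised, as is needed for the codifferential of a 2-form.\<close>
  define W where "W y = (2 / bdf y) ^ (CARD('n) - 2)" for y :: "real^'n"
  define W2 where "W2 y = (2 / bdf y) ^ CARD('n) * ((bdf y)\<^sup>2 / 4)\<^sup>2" for y :: "real^'n"
  have sv: "\<And>i. smooth_fun (ball 0 1) (\<lambda>y. v y $ i)"
    and dv: "\<And>y. y \<in> ball 0 1 \<Longrightarrow> rdiv hyp_metric v y = 0"
    and harm: "\<And>y. y \<in> ball 0 1 \<Longrightarrow> hodge_laplacian1 hyp_metric ?\<alpha> y = 0"
    and L2: "L2_form hyp_metric (ball 0 1) ?\<alpha>"
    using v by (auto simp: hyp_stationary_L2_harmonic_def stationary_L2_harmonic_def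
        steady_euler_def smooth_field_def harmonic1_def)
  have sa: "smooth_fun (ball 0 1) (a i)" for i
    unfolding a_def flat_hyp by (intro smooth_fun_mult smooth_conformal_factor sv open_ball)
  have sW: "smooth_fun (ball 0 1) W"
    unfolding W_def by (rule smooth_weight)
  have sW2: "smooth_fun (ball 0 1) W2"
    unfolding W2_def power2_eq_square[of "bdf _"] divide_inverse[of _ 4]
    by (intro smooth_fun_mult smooth_weight smooth_fun_power smooth_bdf smooth_fun_const open_ball)
  have split: "(2 / bdf y) ^ CARD('n) = W y * (4 / (bdf y)\<^sup>2)" for y
  proof -
    have "CARD('n) = (CARD('n) - 2) + 2" using n by simp
    then have "(2 / bdf y) ^ CARD('n) = (2 / bdf y) ^ (CARD('n) - 2) * (2 / bdf y)\<^sup>2"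
      by (metis power_add)
    then show ?thesis by (simp add: W_def power_divide)
  qed
  have W2_eq: "4 * W2 y / (bdf y)\<^sup>2 = W y" if "y \<in> ball 0 1" for y
    using bdf_nonzero[OF that] by (simp add: W2_def split power2_eq_square)
  have Wpos: "0 < W y" if "y \<in> ball 0 1" for y
    using bdf_pos[OF that] by (simp add: W_def)
  have coclosed: "(\<Sum>i\<in>UNIV. partial i (\<lambda>y. W y * a i y) y) = 0" if "y \<in> ball 0 1" for y
    using dv[OF that] unfolding rdiv_hyp_eq_0_iff[OF that] by (simp add: a_def flat_hyp split mult.assoc)
  have coclosed2: "(\<Sum>i\<in>UNIV. partial i (\<lambda>y. W2 y * (partial i (a j) y - partial j (a i) y)) y) = 0"
    if y: "y \<in> ball 0 1" for j y
  proof -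
    have "codiff2 hyp_metric (d1 ?\<alpha>) y $ j = 0"
      using hodge_laplacian_hyp_solenoidal[OF dv y] harm[OF y] by simp
    then show ?thesis
      using bdf_nonzero[OF y] unfolding codiff2_hyp[OF y]
      by (simp add: d1_def W2_def a_def[abs_def])
  qed
  let ?E = "\<lambda>y. indicator (ball 0 1) y * (W y * (\<Sum>i\<in>UNIV. (a i y)\<^sup>2))"
  have E: "integrable lborel ?E"
  proof (rule integrableI_nonneg)
    have "continuous_on (ball 0 1) (\<lambda>y. W y * (\<Sum>i\<in>UNIV. (a i y)\<^sup>2))"
      by (intro smooth_fun_continuous_on smooth_fun_mult sW smooth_fun_sum smooth_fun_power sa open_ball)
    from borel_measurable_continuous_on_indicator[OF _ this]
    show "?E \<in> borel_measurable lborel" by simp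
    show "AE y in lborel. 0 \<le> ?E y"
      using Wpos by (intro AE_I2) (auto simp: indicator_def less_imp_le intro!: mult_nonneg_nonneg sum_nonneg)
    \<comment> \<open>\<open>?E\<close> is the hyperbolic \<open>L\<^sup>2\<close> density in
      coordinates: one inverse metric factor combines with the volume density to
      \<open>W\<close>.\<close>
    have "ennreal (?E y) = indicator (ball 0 1) y * ennreal (form_norm2 hyp_metric ?\<alpha> y * vol_density hyp_metric y)"
      for y
      using bdf_nonzero[of y]
      by (cases "y \<in> ball 0 1") (simp_all add: form_norm2_hyp vol_density_hyp split a_def mult_ac)
    then show "(\<integral>\<^sup>+ y. ennreal (?E y) \<partial>lborel) < \<infinity>"
      using L2 unfolding L2_form_def by simp
  qed
  have closed: "partial i (a j) y = partial j (a i) y" if y: "y \<in> ball 0 1" for i j y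
  proof (rule coclosed_d_imp_closed[OF sa sW2 _ coclosed2 _ y])
    show "0 < W2 y" if "y \<in> ball 0 1" for y
      using bdf_pos[OF that] by (simp add: W2_def)
    have "?E = (\<lambda>x. indicator (ball 0 1) x * (4 * W2 x / (bdf x)\<^sup>2 * (\<Sum>i\<in>UNIV. (a i x)\<^sup>2)))"
    proof
      fix y
      show "?E y = indicator (ball 0 1) y * (4 * W2 y / (bdf y)\<^sup>2 * (\<Sum>i\<in>UNIV. (a i y)\<^sup>2))"
        using W2_eq[of y] by (cases "y \<in> ball 0 1") (simp_all only: indicator_simps simp_thms mult_zero_left)
    qed
    with E show "integrable lborel (\<lambda>x. indicator (ball 0 1) x * (4 * W2 x / (bdf x)\<^sup>2 * (\<Sum>i\<in>UNIV. (a i x)\<^sup>2)))"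
      by simp
  qed auto
  have "a i x = 0" for i
    by (rule L2_closed_coclosed_imp_zero[OF n sa closed coclosed[unfolded W_def] E[unfolded W_def] x])
  then show ?thesis
    using bdf_nonzero[OF x] by (simp add: a_def flat_hyp vec_eq_iff)
qed

section \<open>Steady fields from harmonic polynomials\<close>

text \<open>The formula for a conformally flat metric: the logarithm of the factor
  \<open>2 / bdf x\<close> has partial derivatives \<open>2 * x $ i / bdf x\<close>.\<close>

lemma christoffel_hyp:
  fixes x :: "real^'n::finite"
  assumes x: "x \<in> ball 0 1"
  shows "christoffel hyp_metric k i j x
    = 2 / bdf x * ((if j = k then x $ i else 0) + (if i = k then x $ j else 0) - (if i = j then x $ k else 0))"
proof -
  have g: "partial i (\<lambda>y. hyp_metric y $ j $ l) x = (if j = l then 16 * x $ i / bdf x ^ 3 else 0)" for i j l :: 'n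
  proof (cases "j = l")
    case True
    then have "(\<lambda>y. hyp_metric y $ j $ l) = (\<lambda>y. (2 / bdf y)\<^sup>2)"
      by (simp add: hyp_metric_entry power_divide)
    then show ?thesis
      using partial_weight[OF x, of i 2] True
      by (simp add: power_divide power2_eq_square power3_eq_cube)
  next
    case False
    then have "(\<lambda>y. hyp_metric y $ j $ l) = (\<lambda>y. 0)"
      by (simp add: hyp_metric_entry)
    then show ?thesis using False by simp
  qed
  have "christoffel hyp_metric k i j x = 1/2 * (\<Sum>l\<in>UNIV. if k = l then (bdf x)\<^sup>2 / 4 *
      ((if j = l then 16 * x $ i / bdf x ^ 3 else 0) + (if i = l then 16 * x $ j / bdf x ^ 3 else 0)
        - (if i = j then 16 * x $ l / bdf x ^ 3 else 0)) else 0)"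
    unfolding christoffel_def ginv_hyp_entry[OF x] g by (intro arg_cong[of _ _ "\<lambda>s. 1/2 * s"] sum.cong refl) auto
  also have "\<dots> = 1/2 * ((bdf x)\<^sup>2 / 4 *
      ((if j = k then 16 * x $ i / bdf x ^ 3 else 0) + (if i = k then 16 * x $ j / bdf x ^ 3 else 0)
        - (if i = j then 16 * x $ k / bdf x ^ 3 else 0)))"
    by simp
  also have "\<dots> = 2 / bdf x * ((if j = k then x $ i else 0) + (if i = k then x $ j else 0)
       - (if i = j then x $ k else 0))"
    using bdf_nonzero[OF x] by (auto simp: field_simps power2_eq_square power3_eq_cube)
  finally show ?thesis .
qed

lemma covder_hyp:
  fixes v :: "real^'n::finite \<Rightarrow> real^'n"
  assumes x: "x \<in> ball 0 1"
  shows "covder hyp_metric v v x $ k = (\<Sum>i\<in>UNIV. v x $ i * partial i (\<lambda>y. v y $ k) x)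
    + 2 / bdf x * (2 * v x $ k * (\<Sum>i\<in>UNIV. x $ i * v x $ i) - x $ k * (\<Sum>i\<in>UNIV. (v x $ i)\<^sup>2))"
proof -
  have "(\<Sum>i\<in>UNIV. \<Sum>j\<in>UNIV. christoffel hyp_metric k i j x * v x $ i * v x $ j)
    = (\<Sum>i\<in>UNIV. \<Sum>j\<in>UNIV. (if k = j then 2 / bdf x * (x $ i * v x $ i * v x $ j) else 0)
        + (if k = i then 2 / bdf x * (x $ j * v x $ i * v x $ j) else 0)
        - (if i = j then 2 / bdf x * (x $ k * v x $ i * v x $ j) else 0))"
    unfolding christoffel_hyp[OF x] by (intro sum.cong refl) (auto simp: algebra_simps)
  also have "\<dots> = (\<Sum>i\<in>UNIV. \<Sum>j\<in>UNIV. if k = j then 2 / bdf x * (x $ i * v x $ i * v x $ j) else 0)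
      + (\<Sum>j\<in>UNIV. \<Sum>i\<in>UNIV. if k = i then 2 / bdf x * (x $ j * v x $ i * v x $ j) else 0)
      - (\<Sum>i\<in>UNIV. \<Sum>j\<in>UNIV. if i = j then 2 / bdf x * (x $ k * v x $ i * v x $ j) else 0)"
    unfolding sum.distrib sum_subtractf
      sum.swap[of "\<lambda>i j. if k = i then 2 / bdf x * (x $ j * v x $ i * v x $ j) else 0"] ..
  also have "\<dots> = (\<Sum>i\<in>UNIV. 2 / bdf x * (x $ i * v x $ i * v x $ k))
      + (\<Sum>j\<in>UNIV. 2 / bdf x * (x $ j * v x $ k * v x $ j))
      - (\<Sum>i\<in>UNIV. 2 / bdf x * (x $ k * v x $ i * v x $ i))"
    by simp
  also have "\<dots> = 2 / bdf x * (2 * v x $ k * (\<Sum>i\<in>UNIV. x $ i * v x $ i) - x $ k * (\<Sum>i\<in>UNIV. (v x $ i)\<^sup>2))"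
    by (simp add: sum_distrib_left sum_subtractf[symmetric] sum.distrib[symmetric] right_diff_distrib
        power2_eq_square mult_ac)
  finally show ?thesis by (simp add: covder_def)
qed

text \<open>\<open>v\<close> is the field dual to \<open>a\<close>, and the pressure is minus half
  its squared hyperbolic length. The form may be arbitrary outside the ball.\<close>

lemma hyp_stationary_if_closed_coclosed:
  fixes a :: "'n::finite \<Rightarrow> real^'n \<Rightarrow> real"
  defines "v \<equiv> \<lambda>x. \<chi> i. (bdf x)\<^sup>2 / 4 * a i x"
  assumes a: "\<And>i. smooth_fun (ball 0 1) (a i)"
    and closed: "\<And>i j x. x \<in> ball 0 1 \<Longrightarrow> partial i (a j) x = partial j (a i) x"
    and coclosed: "\<And>x. x \<in> ball 0 1 \<Longrightarrow>
      (\<Sum>i\<in>UNIV. partial i (\<lambda>y. (2 / bdf y) ^ CARD('n) * ((bdf y)\<^sup>2 / 4 * a i y)) x) = 0"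
    and L2: "(\<integral>\<^sup>+ x. indicator (ball 0 1) x *
      ennreal ((bdf x)\<^sup>2 / 4 * (\<Sum>i\<in>UNIV. (a i x)\<^sup>2) * (2 / bdf x) ^ CARD('n)) \<partial>lborel) < \<infinity>"
  shows "hyp_stationary_L2_harmonic v"
proof -
  define L where "L x = (bdf x)\<^sup>2 / 4" for x :: "real^'n"
  have sL: "smooth_fun (ball 0 1) L"
    unfolding L_def divide_inverse
    by (intro smooth_fun_mult smooth_fun_power smooth_bdf smooth_fun_const open_ball)
  have sv: "smooth_fun (ball 0 1) (\<lambda>x. v x $ i)" for i
    unfolding v_def L_def[symmetric] by (simp add: smooth_fun_mult[OF open_ball sL a])
  have v: "v x $ i = L x * a i x" for x i by (simp add: v_def L_def)
  have dv: "rdiv hyp_metric v x = 0" if "x \<in> ball 0 1" for x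
    using coclosed[OF that] by (simp add: rdiv_hyp_eq_0_iff[OF that] v L_def)
  have fl: "flat hyp_metric v x $ i = a i x" if "x \<in> ball 0 1" for x i
    using bdf_nonzero[OF that] by (simp add: flat_hyp v L_def)
  have pL: "partial i L x = - bdf x * x $ i" for i x
  proof -
    have "partial i (\<lambda>x. 1/4 * (bdf x)\<^sup>2) x = 1/4 * partial i (\<lambda>x. (bdf x)\<^sup>2) x"
      by (rule partial_cmult) simp
    then show ?thesis by (simp add: L_def[abs_def] partial_power partial_bdf)
  qed
  define A where "A x = (\<Sum>j\<in>UNIV. a j x * a j x)" for x
  have sA: "smooth_fun (ball 0 1) A"
    unfolding A_def by (intro smooth_fun_sum smooth_fun_mult a open_ball)
  \<comment> \<open>\<open>L x * A x\<close> is the squared length of \<open>v\<close>, as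
    \<open>L\<close> is the diagonal entry of the inverse metric.\<close>
  define p where "p x = - (1/2) * (L x * A x)" for x
  have sLA: "smooth_fun (ball 0 1) (\<lambda>x. L x * A x)"
    by (rule smooth_fun_mult[OF open_ball sL sA])
  then have sp: "smooth_fun (ball 0 1) p"
    unfolding p_def by (intro smooth_fun_mult[OF open_ball smooth_fun_const[OF open_ball]])
  have euler: "covder hyp_metric v v x = - rgrad hyp_metric p x" if x: "x \<in> ball 0 1" for x
  proof -
    note diff = smooth_fun_differentiable[OF _ x]
    \<comment> \<open>Closedness exchanges the indices of the derivative, so that the gradient of
      \<open>A\<close> is twice the Euclidean convective term of \<open>a\<close>.\<close>
    have pA: "partial i A x = 2 * (\<Sum>j\<in>UNIV. a j x * partial j (a i) x)" for i
      unfolding A_def using diff[OF a] closed[OF x, of i]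
      by (subst partial_sum) (auto simp: partial_mult sum_distrib_left mult_ac intro!: sum.cong)
    have "covder hyp_metric v v x $ k = - rgrad hyp_metric p x $ k" for k
    proof -
      define Q where "Q = (\<Sum>i\<in>UNIV. x $ i * a i x)"
      define R where "R = (\<Sum>i\<in>UNIV. a i x * partial i (a k) x)"
      have "(\<Sum>i\<in>UNIV. v x $ i * partial i (\<lambda>y. v y $ k) x)
         = (\<Sum>i\<in>UNIV. L x * L x * (a i x * partial i (a k) x) - L x * bdf x * a k x * (x $ i * a i x))"
        unfolding v partial_mult[OF diff[OF sL] diff[OF a]] pL
        by (intro sum.cong refl) (simp add: algebra_simps)
      also have "\<dots> = L x * L x * R - L x * bdf x * a k x * Q"
        unfolding sum_subtractf R_def Q_def sum_distrib_left[symmetric] ..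
      finally have 1: "(\<Sum>i\<in>UNIV. v x $ i * partial i (\<lambda>y. v y $ k) x)
          = L x * L x * R - L x * bdf x * a k x * Q" .
      have 2: "(\<Sum>i\<in>UNIV. x $ i * v x $ i) = L x * Q" "(\<Sum>i\<in>UNIV. (v x $ i)\<^sup>2) = L x * L x * A x"
        by (simp_all add: v Q_def A_def sum_distrib_left power2_eq_square mult_ac)
      have 3: "partial k p x = - (1/2) * (L x * (2 * R) - bdf x * x $ k * A x)"
        unfolding p_def partial_cmult[OF diff[OF sLA]] partial_mult[OF diff[OF sL] diff[OF sA]] pA pL
        by (simp add: R_def)
      have 4: "2 / bdf x * L x = bdf x / 2"
        using bdf_nonzero[OF x] by (simp add: L_def power2_eq_square)
      have "covder hyp_metric v v x $ k = L x * L x * R - L x * bdf x * a k x * Q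
          + 2 / bdf x * (2 * v x $ k * (L x * Q) - x $ k * (L x * L x * A x))"
        unfolding covder_hyp[OF x] 1 2 ..
      also have "\<dots> = L x * L x * R - L x * bdf x * a k x * Q
          + (2 / bdf x * L x) * L x * (2 * a k x * Q - x $ k * A x)"
        unfolding v by (simp add: algebra_simps)
      \<comment> \<open>The terms with \<open>Q\<close>, one from differentiating \<open>L\<close>
        and one from the Christoffel symbols, cancel.\<close>
      finally show ?thesis
        unfolding rgrad_hyp[OF x] 3 4 L_def[symmetric] by (simp add: algebra_simps)
    qed
    then show ?thesis by (simp add: vec_eq_iff)
  qed
  have harm: "hodge_laplacian1 hyp_metric (flat hyp_metric v) x = 0" if x: "x \<in> ball 0 1" for x
  proof -
    have "d1 (flat hyp_metric v) y $ i $ k = 0" if y: "y \<in> ball 0 1" for y i k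
    proof -
      have "partial i (\<lambda>z. flat hyp_metric v z $ k) y = partial i (a k) y" for i k
        by (rule partial_cong[OF open_ball y fl])
      then show ?thesis using closed[OF y] by (simp add: d1_def)
    qed
    then have "partial i (\<lambda>y. (2 / bdf y) ^ CARD('n) * ((bdf y)\<^sup>2 / 4)\<^sup>2 * d1 (flat hyp_metric v) y $ i $ k) x
        = partial i (\<lambda>y. 0) x" for i k
      by (intro partial_cong[OF open_ball x]) simp
    then show ?thesis
      using hodge_laplacian_hyp_solenoidal[OF dv x] by (simp add: vec_eq_iff codiff2_hyp[OF x])
  qed
  have "indicator (ball 0 1) x * ennreal (form_norm2 hyp_metric (flat hyp_metric v) x * vol_density hyp_metric x)
    = indicator (ball 0 1) x *
      ennreal ((bdf x)\<^sup>2 / 4 * (\<Sum>i\<in>UNIV. (a i x)\<^sup>2) * (2 / bdf x) ^ CARD('n))" for x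
    by (cases "x \<in> ball 0 1") (simp_all add: form_norm2_hyp vol_density_hyp fl)
  then have "L2_form hyp_metric (ball 0 1) (flat hyp_metric v)"
    using L2 by (simp add: L2_form_def)
  then show ?thesis
    using sv sp dv euler harm
    by (auto simp: hyp_stationary_L2_harmonic_def stationary_L2_harmonic_def steady_euler_def
        smooth_field_def harmonic1_def)
qed

section \<open>Polynomial fields on the disc\<close>

definition plane_complex :: "real^2 \<Rightarrow> complex" where
  "plane_complex x = of_real (x $ 1) + \<i> * of_real (x $ 2)"

text \<open>For \<open>q = h'\<close> these are the components of \<open>d (Re h)\<close>, by the Cauchy-Riemann equations.\<close>

definition poly_form :: "complex poly \<Rightarrow> 2 \<Rightarrow> real^2 \<Rightarrow> real" where
  "poly_form q i x = (if i = 1 then Re (poly q (plane_complex x)) else - Im (poly q (plane_complex x)))"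

definition poly_field :: "complex poly \<Rightarrow> real^2 \<Rightarrow> real^2" where
  "poly_field q x = (\<chi> i. (bdf x)\<^sup>2 / 4 * poly_form q i x)"

text \<open>Both parts are treated at once, since the complex multiplication in the Horner step
  mixes them.\<close>

lemma smooth_fun_poly_complex:
  assumes "open U"
  shows "smooth_fun U (\<lambda>x. Re (poly q (plane_complex x))) \<and> smooth_fun U (\<lambda>x. Im (poly q (plane_complex x)))"
proof (induction q)
  case (pCons c q)
  then show ?case using assms
    by (auto simp: plane_complex_def intro!: smooth_fun_add smooth_fun_diff smooth_fun_mult
        smooth_fun_const smooth_fun_coord)
qed (simp add: smooth_fun_const assms)

lemma smooth_poly_form:
  assumes "open U"
  shows "smooth_fun U (poly_form q i)"
proof (cases "i = 1")
  case True
  then show ?thesis using smooth_fun_poly_complex[OF assms] by (simp add: poly_form_def[abs_def])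
next
  case False
  then show ?thesis
    using smooth_fun_diff[OF assms smooth_fun_const[OF assms, of 0]] smooth_fun_poly_complex[OF assms]
    by (simp add: poly_form_def[abs_def])
qed

text \<open>The derivative of \<open>q\<close> is multiplication by \<open>pderiv q\<close>, and the
  two axes correspond to 1 and \<open>\<i>\<close>. Equal mixed entries and zero trace are
  closedness and Euclidean coclosedness.\<close>

lemma partial_poly_form:
  "partial 1 (poly_form q 1) x = Re (poly (pderiv q) (plane_complex x))"
  "partial 2 (poly_form q 1) x = - Im (poly (pderiv q) (plane_complex x))"
  "partial 1 (poly_form q 2) x = - Im (poly (pderiv q) (plane_complex x))"
  "partial 2 (poly_form q 2) x = - Re (poly (pderiv q) (plane_complex x))"
proof -
  let ?d = "poly (pderiv q) (plane_complex x)"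
  have coord: "((\<lambda>x::real^2. x $ i) has_derivative (\<lambda>h. h $ i)) (at x)" for i x
    by (rule bounded_linear_imp_has_derivative) (rule bounded_linear_vec_nth)
  have "(plane_complex has_derivative plane_complex) (at x)"
    unfolding plane_complex_def[abs_def] by (auto intro!: derivative_eq_intros coord)
  moreover have "(poly q has_derivative (*) ?d) (at (plane_complex x))"
    using poly_DERIV[of q "plane_complex x"] by (simp add: has_field_derivative_def)
  ultimately have *: "((\<lambda>x. poly q (plane_complex x)) has_derivative (\<lambda>h. ?d * plane_complex h)) (at x)"
    by (rule has_derivative_compose)
  have 1: "(poly_form q 1 has_derivative (\<lambda>h. Re (?d * plane_complex h))) (at x)"
    unfolding poly_form_def[abs_def] using has_derivative_Re[OF *] by simp
  have 2: "(poly_form q 2 has_derivative (\<lambda>h. - Im (?d * plane_complex h))) (at x)"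
    unfolding poly_form_def[abs_def] using has_derivative_minus[OF has_derivative_Im[OF *]] by simp
  have "plane_complex (axis 1 1) = 1" "plane_complex (axis 2 1) = \<i>"
    by (simp_all add: plane_complex_def axis_def)
  then show
    "partial 1 (poly_form q 1) x = Re ?d" "partial 2 (poly_form q 1) x = - Im ?d"
    "partial 1 (poly_form q 2) x = - Im ?d" "partial 2 (poly_form q 2) x = - Re ?d"
    by (simp_all add: partial_eq[OF 1] partial_eq[OF 2])
qed

text \<open>In dimension 2 the volume density cancels the inverse metric. Coclosedness and the
  \<open>L\<^sup>2\<close> norm thus become Euclidean, and polynomials are bounded on the closed
  disc.\<close>

lemma hyp_stationary_poly_field: "hyp_stationary_L2_harmonic (poly_field q)"
  unfolding poly_field_def[abs_def]
proof (rule hyp_stationary_if_closed_coclosed)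
  have weight: "(2 / bdf y) ^ CARD(2) * ((bdf y)\<^sup>2 / 4 * c) = c" if "y \<in> ball 0 1" for y :: "real^2" and c
    using bdf_nonzero[OF that] by (simp add: power_divide)
  show "smooth_fun (ball 0 1) (poly_form q i)" for i
    by (rule smooth_poly_form) simp
  show "partial i (poly_form q j) x = partial j (poly_form q i) x" for i j x
    using exhaust_2[of i] exhaust_2[of j] by (auto simp: partial_poly_form)
  show "(\<Sum>i\<in>UNIV. partial i (\<lambda>y. (2 / bdf y) ^ CARD(2) * ((bdf y)\<^sup>2 / 4 * poly_form q i y)) x) = 0"
    if x: "x \<in> ball 0 1" for x
  proof -
    have "partial i (\<lambda>y. (2 / bdf y) ^ CARD(2) * ((bdf y)\<^sup>2 / 4 * poly_form q i y)) x
        = partial i (poly_form q i) x" for i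
      by (rule partial_cong[OF open_ball x weight])
    then show ?thesis by (simp add: sum_2 partial_poly_form)
  qed
  let ?N = "\<lambda>x. \<Sum>i\<in>UNIV. (poly_form q i x)\<^sup>2"
  have "continuous_on (cball 0 1) ?N"
    using smooth_fun_continuous_on[OF smooth_poly_form[OF open_UNIV]]
    by (intro continuous_intros) (blast intro: continuous_on_subset)
  from borel_integrable_compact[OF compact_cball this]
  have "integrable lborel (\<lambda>x. indicator (cball 0 1) x *\<^sub>R ?N x)" .
  then have fin: "(\<integral>\<^sup>+ x. ennreal (norm (indicator (cball 0 1) x *\<^sub>R ?N x)) \<partial>lborel) < \<infinity>"
    by (simp only: integrable_iff_bounded)
  have "(\<integral>\<^sup>+ x. indicator (ball 0 1) x *
      ennreal ((bdf x)\<^sup>2 / 4 * ?N x * (2 / bdf x) ^ CARD(2)) \<partial>lborel)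
    \<le> (\<integral>\<^sup>+ x. ennreal (norm (indicator (cball 0 1) x *\<^sub>R ?N x)) \<partial>lborel)"
  proof (rule nn_integral_mono)
    fix x :: "real^2"
    show "indicator (ball 0 1) x * ennreal ((bdf x)\<^sup>2 / 4 * ?N x * (2 / bdf x) ^ CARD(2))
      \<le> ennreal (norm (indicator (cball 0 1) x *\<^sub>R ?N x))"
    proof (cases "x \<in> ball 0 1")
      case True
      have "(bdf x)\<^sup>2 / 4 * ?N x * (2 / bdf x) ^ CARD(2) = ?N x"
        using bdf_nonzero[OF True] by (simp add: power_divide)
      then show ?thesis using True by (simp only: indicator_simps) (simp add: sum_nonneg)
    qed simp
  qed
  with fin show "(\<integral>\<^sup>+ x. indicator (ball 0 1) x *
      ennreal ((bdf x)\<^sup>2 / 4 * ?N x * (2 / bdf x) ^ CARD(2)) \<partial>lborel) < \<infinity>"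
    by (rule le_less_trans[rotated])
qed

section \<open>Linear structure and independence\<close>

lemma poly_field_add: "(\<lambda>x. poly_field q x + poly_field r x) = poly_field (q + r)"
  by (rule ext) (simp add: poly_field_def poly_form_def vec_eq_iff algebra_simps)

lemma poly_field_scale: "(\<lambda>x. c *\<^sub>R poly_field q x) = poly_field (smult (of_real c) q)"
  by (rule ext) (simp add: poly_field_def poly_form_def vec_eq_iff algebra_simps)

lemma poly_field_0: "poly_field 0 = (\<lambda>x. 0)"
  by (rule ext) (simp add: poly_field_def poly_form_def vec_eq_iff)

lemma norm_axis: "norm (axis i t :: real^'n::finite) = \<bar>t\<bar>"
  by (simp add: norm_eq_sqrt_inner inner_axis_axis real_sqrt_mult_self)

text \<open>On the real diameter the fields of monomials become powers of \<open>t\<close> times a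
  common factor, nonzero for \<open>\<bar>t\<bar> < 1\<close>. Independence thus reduces to that of
  the powers.\<close>

lemma poly_field_monom_real_axis:
  "poly_field (monom 1 m) (axis 1 t) $ 1 = (1 - t\<^sup>2)\<^sup>2 / 4 * t ^ m"
proof -
  have "plane_complex (axis 1 t) = of_real t"
    by (simp add: plane_complex_def axis_def)
  then show ?thesis
    by (simp add: poly_field_def poly_form_def poly_monom bdf_def norm_axis flip: of_real_power)
qed

lemma poly_field_monom_independent:
  assumes "\<And>x. x \<in> ball 0 1 \<Longrightarrow> (\<Sum>m<N. c m *\<^sub>R poly_field (monom 1 m) x) = 0" "m < N"
  shows "c m = 0"
proof -
  have "(\<Sum>m<N. c m * t ^ m) = 0" if t: "t \<in> {0<..<1}" for t :: real
  proof -
    have "t\<^sup>2 < 1" using t by (simp add: power_less_one_iff)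
    have "(\<Sum>m<N. c m *\<^sub>R poly_field (monom 1 m) (axis 1 t)) $ 1 = 0"
      using t by (subst assms(1)) (auto simp: norm_axis)
    moreover have "(\<Sum>m<N. c m *\<^sub>R poly_field (monom 1 m) (axis 1 t)) $ 1
        = (1 - t\<^sup>2)\<^sup>2 / 4 * (\<Sum>m<N. c m * t ^ m)"
      by (simp add: poly_field_monom_real_axis sum_distrib_left sum_distrib_right mult_ac)
    ultimately show ?thesis using \<open>t\<^sup>2 < 1\<close> by simp
  qed
  \<comment> \<open>\<open>N\<close> is positive because \<open>m < N\<close>; the bound on the
    number of roots is stated for sums up to a degree.\<close>
  moreover have "{..<N} = {..N - 1}" using assms(2) by auto
  ultimately have "{0<..<1} \<subseteq> {t. (\<Sum>m\<le>N - 1. c m * t ^ m) = 0}" by auto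
  then have "infinite {t. (\<Sum>m\<le>N - 1. c m * t ^ m) = 0}"
    by (rule infinite_super) (simp add: infinite_Ioo)
  then show ?thesis
    using polyfun_finite_roots[of c "N - 1"] assms(2) by auto
qed

lemma inj_poly_field_monom: "inj (\<lambda>m. poly_field (monom 1 m))"
proof (rule injI)
  fix m n assume "poly_field (monom 1 m) = poly_field (monom 1 n)"
  \<comment> \<open>At \<open>t = 1/2\<close> the common factor is nonzero and the powers of
    \<open>t\<close> are distinct.\<close>
  from arg_cong[OF this, of "\<lambda>f. f (axis 1 (1/2)) $ 1"] show "m = n"
    by (simp add: poly_field_monom_real_axis power_divide)
qed

text \<open>The coefficients in \<open>lin_indep_fields\<close> are indexed by the fields
  themselves; injectivity translates them to exponents and gives the cardinality.\<close>

lemma poly_field_lin_indep: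
  "\<exists>F\<subseteq>range poly_field. finite F \<and> card F = N \<and> lin_indep_fields (ball 0 1) F"
proof -
  let ?e = "\<lambda>m. poly_field (monom 1 m)"
  have inj: "inj_on ?e {..<N}"
    using inj_poly_field_monom by (rule inj_on_subset) simp
  have "lin_indep_fields (ball 0 1) (?e ` {..<N})"
    unfolding lin_indep_fields_def sum.reindex[OF inj] o_def
  proof (intro allI impI ballI)
    fix c f
    assume c: "\<forall>x\<in>ball 0 1. (\<Sum>m<N. c (?e m) *\<^sub>R ?e m x) = 0" and "f \<in> ?e ` {..<N}"
    then obtain m where m: "m < N" and f: "f = ?e m" by blast
    show "c f = 0"
      unfolding f
      by (rule poly_field_monom_independent[where N = N and c = "\<lambda>m. c (?e m)", OF _ m])
        (rule bspec[OF c])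
  qed
  moreover have "card (?e ` {..<N}) = N"
    by (simp add: card_image[OF inj])
  ultimately show ?thesis
    by (intro exI[of _ "?e ` {..<N}"]) auto
qed

theorem theorem1p1:
  shows "(\<exists>V :: (real^2 \<Rightarrow> real^2) set.
            (\<forall>v\<in>V. hyp_stationary_L2_harmonic v) \<and>
            (\<lambda>x. 0) \<in> V \<and>
            (\<forall>v\<in>V. \<forall>w\<in>V. (\<lambda>x. v x + w x) \<in> V) \<and>
            (\<forall>c::real. \<forall>v\<in>V. (\<lambda>x. c *\<^sub>R v x) \<in> V) \<and>
            (\<forall>N::nat. \<exists>F\<subseteq>V. finite F \<and> card F = N \<and> lin_indep_fields (ball 0 1) F))
       \<and> (CARD('n::finite) > 2 \<longrightarrow>
            (\<forall>v :: real^'n \<Rightarrow> real^'n. hyp_stationary_L2_harmonic v \<longrightarrow>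
               (\<forall>x\<in>ball 0 1. v x = 0)))"
proof (intro conjI impI allI ballI)
  show "v x = 0" if "CARD('n) > 2" "hyp_stationary_L2_harmonic v" "x \<in> ball 0 1"
    for v :: "real^'n \<Rightarrow> real^'n" and x
    using that by (rule hyp_stationary_L2_harmonic_imp_zero)
  show "\<exists>V :: (real^2 \<Rightarrow> real^2) set.
            (\<forall>v\<in>V. hyp_stationary_L2_harmonic v) \<and>
            (\<lambda>x. 0) \<in> V \<and>
            (\<forall>v\<in>V. \<forall>w\<in>V. (\<lambda>x. v x + w x) \<in> V) \<and>
            (\<forall>c::real. \<forall>v\<in>V. (\<lambda>x. c *\<^sub>R v x) \<in> V) \<and>
            (\<forall>N::nat. \<exists>F\<subseteq>V. finite F \<and> card F = N \<and> lin_indep_fields (ball 0 1) F)"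
  \<comment> \<open>The witness comes from all complex polynomials; real scalars act through
    \<open>smult\<close>, so its range is a real vector space.\<close>
  proof (rule exI[of _ "range poly_field"], intro conjI)
    show "\<forall>v\<in>range poly_field. hyp_stationary_L2_harmonic v"
      by (auto simp: hyp_stationary_poly_field)
    show "(\<lambda>x. 0) \<in> range poly_field"
      unfolding poly_field_0[symmetric] by (rule rangeI)
    show "\<forall>v\<in>range poly_field. \<forall>w\<in>range poly_field. (\<lambda>x. v x + w x) \<in> range poly_field"
      by (auto simp: poly_field_add)
    show "\<forall>c. \<forall>v\<in>range poly_field. (\<lambda>x. c *\<^sub>R v x) \<in> range poly_field"
      by (auto simp: poly_field_scale)
    show "\<forall>N. \<exists>F\<subseteq>range poly_field. finite F \<and> card F = N \<and> lin_indep_fields (ball 0 1) F"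
      using poly_field_lin_indep by (rule allI)
  qed
qed

end
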